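(* Let $V$ be a finite set with $|V|=N\ge 1$, let $(Y_k)_{k\in V}$ be a family of real-valued square-integrable random variables admitting a dependency graph of maximal degree $D\in\mathbb{Z}_{\ge 0}$, and let $(c_k)_{k\in V}$ be an arbitrary family of real numbers. Put $S=\sum_{k\in V}Y_k$, $v=\sqrt{\operatorname{Var}[S]}$, $W=(S-\mathbb{E}[S])/v$, and assume that $v>0$ and that $\mathcal{A}_\delta=\sum_{k\in V}\mathbb{E}[|Y_k-c_k|^\delta]<\infty$ for some $\delta\in(2,3)$. Let $$\xi_\delta=\left(\frac{N}{\mathcal{A}_\delta}\right)^{\frac1\delta}\sqrt{\frac{\operatorname{Var}[S]}{N(D+1)}}.$$ Then $$d_{\mathrm{Kol}}\left(W,\mathcal{N}(0,1)\right)\le 8.015\,\xi_\delta^{-\frac{\delta}{\delta+1}}\left(\frac{D+1}{N}\right)^{\frac{\delta-2}{2(\delta+1)}}.$$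
   Context: A multigraph on $V$ (multiple edges and loops allowed; simple graphs included) is a dependency graph of $(Y_k)_{k\in V}$ if, whenever $V_1,V_2\subset V$ are disjoint and no edge has one endpoint in $V_1$ and the other in $V_2$, the families $(Y_k)_{k\in V_1}$ and $(Y_k)_{k\in V_2}$ are independent. The degree of a vertex is the number of edges it belongs to, and the maximal degree is the maximum over all vertices. The Kolmogorov distance between a real random variable $X$ and the standard normal law is $d_{\mathrm{Kol}}(X,\mathcal{N}(0,1))=\sup_{t\in\mathbb{R}}|\mathbb{P}(X\le t)-\mathbb{P}(G\le t)|$ with $G\sim\mathcal{N}(0,1)$. *)

theory Defs
  imports "HOL-Probability.Probability" "HOL-Library.Uprod" "HOL-Library.Multiset"
begin

text \<open>
  A multigraph on a vertex set is given by its edges, a multiset of unordered pairs: multiplicity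
  encodes multiple edges, and the pair \<open>Upair a a\<close> is a loop at \<open>a\<close>. On a finite vertex set of
  finite maximal degree there are only finitely many edges, so finite multisets suffice.
\<close>

definition multigraph_on :: "'a set \<Rightarrow> 'a uprod multiset \<Rightarrow> bool" where
  "multigraph_on V E \<longleftrightarrow> (\<forall>e\<in>#E. set_uprod e \<subseteq> V)"

text \<open>The degree is the number of edges that contain the vertex; a loop therefore counts once.\<close>

definition mg_degree :: "'a uprod multiset \<Rightarrow> 'a \<Rightarrow> nat" where
  "mg_degree E a = size {#e \<in># E. a \<in> set_uprod e#}"

definition mg_max_degree :: "'a set \<Rightarrow> 'a uprod multiset \<Rightarrow> nat" where
  "mg_max_degree V E = Max (mg_degree E ` V)"

text \<open>
  A family \<open>(Y k)\<close>, \<open>k \<in> U\<close>, is regarded as a single random variable with values in the product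
  space indexed by \<open>U\<close>, which is why its values are restricted to \<open>U\<close>.
\<close>

definition dependency_graph ::
    "'w measure \<Rightarrow> 'a set \<Rightarrow> ('a \<Rightarrow> 'w \<Rightarrow> real) \<Rightarrow> 'a uprod multiset \<Rightarrow> bool" where
  "dependency_graph M V Y E \<longleftrightarrow> multigraph_on V E \<and>
    (\<forall>V1 V2. V1 \<subseteq> V \<longrightarrow> V2 \<subseteq> V \<longrightarrow> V1 \<inter> V2 = {} \<longrightarrow>
       (\<forall>a\<in>V1. \<forall>b\<in>V2. Upair a b \<notin># E) \<longrightarrow>
       prob_space.indep_var M
         (PiM V1 (\<lambda>_. borel)) (\<lambda>\<omega>. \<lambda>k\<in>V1. Y k \<omega>)
         (PiM V2 (\<lambda>_. borel)) (\<lambda>\<omega>. \<lambda>k\<in>V2. Y k \<omega>))"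

definition kolmogorov_dist_std_normal :: "'w measure \<Rightarrow> ('w \<Rightarrow> real) \<Rightarrow> real" where
  "kolmogorov_dist_std_normal M X =
    (SUP t. \<bar>measure M {\<omega> \<in> space M. X \<omega> \<le> t} - cdf std_normal_distribution t\<bar>)"

end

theory Submission
  imports Defs
begin

text \<open>
  Write $\Delta = D + 1$ and $X_k = (Y_k - \mathbb{E} Y_k) / v$, so that $W = \sum_k X_k$. Taking all powers
  together, the claimed bound is $8.015\,\epsilon^{1/(\delta+1)}$ with
  $\epsilon = A \Delta^{\delta-1} / v^\delta$. The proof is Stein's method for local dependence,
  combined with Gaussian smoothing of the distribution functions.

  A moment of order \<open>\<delta>\<close> controls the Stein operator on test functions whose derivative is
  Hoelder continuous of order \<open>\<delta> - 2\<close>. Let \<open>f\<close> be such a function, with constant \<open>H\<close>. First, \<open>X k\<close> is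
  independent of the sum over the complement of its closed neighbourhood, so
  $\mathbb{E}[X_k f(W)]$ is, to first order, $\sum_j \mathbb{E}[X_k X_j f'(W)]$ over the neighbours \<open>j\<close> of \<open>k\<close>.
  Secondly, $X_k X_j$ is independent of the sum over the complement of the two neighbourhoods, so
  $\mathbb{E}[X_k X_j f'(W)]$ is close to $\mathbb{E}[X_k X_j]\,\mathbb{E}[f'(W)]$. The covariances of neighbours
  add up to $\mathbb{E} W^2 = 1$. Young's inequality and the power mean inequality turn all remainders into
  sums of $\mathbb{E}|X_k|^\delta$, which gives
  $|\mathbb{E}[W f(W) - f'(W)]| \le 5 H \Delta^{\delta-1} \sum_k \mathbb{E}|X_k|^\delta$
  (lemma \<open>stein_bound\<close>).

  The test functions come from an interpolation, in place of a solution of Stein's equation. For $h > 0$ and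
  $\sigma_s = \sqrt{1 + h^2 - s^2}$ consider $u(s) = \mathbb{E}\,\Phi((t - s W) / \sigma_s)$. Then \<open>u 1\<close> is the
  distribution function at \<open>t\<close> of \<open>W\<close> plus an independent normal variable of standard deviation \<open>h\<close>, and
  \<open>u 0\<close> is the one of a standard normal variable plus the same noise. The derivative of \<open>u\<close> at \<open>s\<close> is
  exactly $-\mathbb{E}[W f(W) - f'(W)]$ where \<open>f\<close> is the explicit function
  $x \mapsto \varphi((t - s x)/\sigma_s)/\sigma_s$. The Hoelder constant of its derivative is of order $s / \sigma_s^3$, the
  derivative of $1/\sigma_s$, so the two smoothed distribution functions differ by $O(1/h)$ times the error in
  \<open>stein_bound\<close> (lemma \<open>interpolation_bound\<close>). Removing the noise costs a term of order \<open>h\<close> (lemma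
  \<open>kolmogorov_dist_le_smoothed\<close>), and $h^2 = 2^\delta \epsilon$ balances the two terms; the factor
  $2^\delta$ comes from replacing the arbitrary centring \<open>c k\<close> by the mean. The resulting bound is of
  order $\sqrt\epsilon$. Where the theorem claims more than the trivial bound 1, \<open>\<epsilon>\<close> is small, and
  $\sqrt\epsilon$ is then smaller than $\epsilon^{1/(\delta+1)}$.
\<close>

section \<open>Mixed absolute moments\<close>

text \<open>
  Young's inequality, in the homogeneous form in which it is applied to products of absolute values.
\<close>

lemma Young_powr:
  fixes x y p q :: real
  assumes "0 \<le> x" "0 \<le> y" "0 < p" "0 < q"
  shows "x powr p * y powr q \<le> (p * x powr (p + q) + q * y powr (p + q)) / (p + q)"
proof (cases "x = 0 \<or> y = 0")
  case True
  then show ?thesis using assms by auto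
next
  case False
  then have "(x powr (p + q)) powr (p / (p + q)) * (y powr (p + q)) powr (q / (p + q))
      \<le> p / (p + q) * x powr (p + q) + q / (p + q) * y powr (p + q)"
    using assms by (intro Youngs_inequality_0) (auto simp flip: add_divide_distrib)
  then show ?thesis
    using assms by (simp add: powr_powr add_divide_distrib)
qed

text \<open>
  The power mean inequality, with \<open>m\<close> an upper bound for the number of terms: every degree in the
  graph can then be replaced by the maximal one. Young's inequality applied to each \<open>\<bar>x l\<bar>\<close> and the mean \<open>a\<close>
  is the tangent line inequality for the power function at \<open>a\<close>; it is summed over \<open>l\<close>.
\<close>

lemma power_mean_powr:
  fixes x :: "'i \<Rightarrow> real" and m p :: real
  assumes "finite B" "real (card B) \<le> m" "0 < m" "1 < p"
  shows "(\<bar>\<Sum>l\<in>B. x l\<bar> / m) powr p \<le> (\<Sum>l\<in>B. \<bar>x l\<bar> powr p) / m"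
proof -
  define a where "a = \<bar>\<Sum>l\<in>B. x l\<bar> / m"
  have a: "0 \<le> a" using assms by (simp add: a_def)
  have "m * a powr p = (m * a) * a powr (p - 1)"
    using a by (cases "a = 0") (auto simp: powr_diff)
  also have "\<dots> \<le> (\<Sum>l\<in>B. \<bar>x l\<bar>) * a powr (p - 1)"
    using assms by (intro mult_right_mono) (auto simp: a_def)
  also have "\<dots> = (\<Sum>l\<in>B. \<bar>x l\<bar> powr 1 * a powr (p - 1))"
    by (simp add: sum_distrib_right)
  also have "\<dots> \<le> (\<Sum>l\<in>B. (\<bar>x l\<bar> powr p + (p - 1) * a powr p) / p)"
    using Young_powr[of _ a 1 "p - 1"] a assms by (intro sum_mono) auto
  also have "\<dots> = ((\<Sum>l\<in>B. \<bar>x l\<bar> powr p) + real (card B) * ((p - 1) * a powr p)) / p"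
    by (simp add: sum.distrib flip: sum_divide_distrib)
  also have "\<dots> \<le> ((\<Sum>l\<in>B. \<bar>x l\<bar> powr p) + m * ((p - 1) * a powr p)) / p"
    using assms by (intro divide_right_mono add_left_mono mult_right_mono) auto
  finally have "m * a powr p * p \<le> (\<Sum>l\<in>B. \<bar>x l\<bar> powr p) + m * ((p - 1) * a powr p)"
    using assms by (simp add: field_simps)
  then have "m * a powr p \<le> (\<Sum>l\<in>B. \<bar>x l\<bar> powr p)"
    by (simp add: algebra_simps)
  then show ?thesis
    using assms by (simp add: a_def field_simps)
qed

text \<open>
  The remainder of the first-order expansion of $\mathbb{E}[X_k f(W)]$ is of this form, with \<open>B\<close> the
  neighbourhood of \<open>k\<close>. Dividing the sum by \<open>m\<close> before applying Young's inequality is what yields the power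
  \<open>m powr (\<delta> - 1)\<close> and not a larger one.
\<close>

lemma mixed_moment_two:
  fixes x :: "'i \<Rightarrow> real" and a m \<delta> :: real
  assumes "finite B" "real (card B) \<le> m" "0 < m" "1 < \<delta>" "0 \<le> a"
  shows "a * \<bar>\<Sum>l\<in>B. x l\<bar> powr (\<delta> - 1)
    \<le> m powr (\<delta> - 1) * ((a powr \<delta> + (\<delta> - 1) * ((\<Sum>l\<in>B. \<bar>x l\<bar> powr \<delta>) / m)) / \<delta>)"
proof -
  define c where "c = \<bar>\<Sum>l\<in>B. x l\<bar> / m"
  have c: "0 \<le> c" using assms by (simp add: c_def)
  have "a * c powr (\<delta> - 1) \<le> (a powr \<delta> + (\<delta> - 1) * c powr \<delta>) / \<delta>"
    using Young_powr[of a c 1 "\<delta> - 1"] assms c by auto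
  also have "\<dots> \<le> (a powr \<delta> + (\<delta> - 1) * ((\<Sum>l\<in>B. \<bar>x l\<bar> powr \<delta>) / m)) / \<delta>"
    using power_mean_powr[of B m \<delta> x] assms
    by (intro divide_right_mono add_left_mono mult_left_mono) (auto simp: c_def)
  finally have "m powr (\<delta> - 1) * (a * c powr (\<delta> - 1)) \<le> m powr (\<delta> - 1) * \<dots>"
    by (intro mult_left_mono) auto
  moreover have "\<bar>\<Sum>l\<in>B. x l\<bar> = m * c" using assms by (simp add: c_def)
  ultimately show ?thesis
    using assms c by (simp add: powr_mult mult_ac)
qed

text \<open>
  The remainder when \<open>X k * X j\<close> is decoupled from \<open>W\<close>. Since \<open>2 * a * b \<le> a\<^sup>2 + b\<^sup>2\<close>, Young's inequality
  with exponents \<open>2\<close> and \<open>\<delta> - 2\<close> suffices. The numbers \<open>a\<close>, \<open>b\<close> and the \<open>x l\<close> are unrelated, so that the bound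
  can also be used with the product and the sum taken at two independent points.
\<close>

lemma mixed_moment_three:
  fixes x :: "'i \<Rightarrow> real" and a b m \<delta> :: real
  assumes "finite B" "real (card B) \<le> m" "0 < m" "2 < \<delta>" "0 \<le> a" "0 \<le> b"
  shows "a * b * \<bar>\<Sum>l\<in>B. x l\<bar> powr (\<delta> - 2)
    \<le> m powr (\<delta> - 2) *
      ((a powr \<delta> + b powr \<delta> + (\<delta> - 2) * ((\<Sum>l\<in>B. \<bar>x l\<bar> powr \<delta>) / m)) / \<delta>)"
proof -
  define c where "c = \<bar>\<Sum>l\<in>B. x l\<bar> / m"
  have c: "0 \<le> c" using assms by (simp add: c_def)
  have sq: "y * y * c powr (\<delta> - 2) \<le> (2 * y powr \<delta> + (\<delta> - 2) * c powr \<delta>) / \<delta>" if "0 \<le> y" for y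
    using Young_powr[of y c 2 "\<delta> - 2"] assms c that by (simp add: power2_eq_square)
  have "a * b \<le> (a * a + b * b) / 2"
    using sum_squares_bound[of a b] by (simp add: power2_eq_square)
  then have "a * b * c powr (\<delta> - 2) \<le> (a * a + b * b) / 2 * c powr (\<delta> - 2)"
    by (intro mult_right_mono) auto
  also have "\<dots> = (a * a * c powr (\<delta> - 2) + b * b * c powr (\<delta> - 2)) / 2"
    by (simp add: algebra_simps)
  also have "\<dots> \<le> ((2 * a powr \<delta> + (\<delta> - 2) * c powr \<delta>) / \<delta>
      + (2 * b powr \<delta> + (\<delta> - 2) * c powr \<delta>) / \<delta>) / 2"
    using sq[of a] sq[of b] assms by (intro divide_right_mono add_mono) auto
  also have "\<dots> = (a powr \<delta> + b powr \<delta> + (\<delta> - 2) * c powr \<delta>) / \<delta>"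
    using assms by (simp add: field_simps)
  also have "\<dots> \<le> (a powr \<delta> + b powr \<delta> + (\<delta> - 2) * ((\<Sum>l\<in>B. \<bar>x l\<bar> powr \<delta>) / m)) / \<delta>"
    using power_mean_powr[of B m \<delta> x] assms
    by (intro divide_right_mono add_left_mono mult_left_mono) (auto simp: c_def)
  finally have "m powr (\<delta> - 2) * (a * b * c powr (\<delta> - 2)) \<le> m powr (\<delta> - 2) * \<dots>"
    by (intro mult_left_mono) auto
  moreover have "\<bar>\<Sum>l\<in>B. x l\<bar> = m * c" using assms by (simp add: c_def)
  ultimately show ?thesis
    using assms c by (simp add: powr_mult mult_ac)
qed

section \<open>Sums over neighbourhoods in the dependency graph\<close>

text \<open>
  Distinct neighbours of \<open>k\<close> are joined to \<open>k\<close> by distinct edges, while multiple edges and loops only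
  increase the degree. The additional 1 accounts for \<open>k\<close> itself.
\<close>

lemma card_neighbours_le_degree:
  assumes "finite V"
  shows "card {j\<in>V. j = k \<or> Upair j k \<in># E} \<le> mg_degree E k + 1"
proof -
  have "card {j\<in>V. j \<noteq> k \<and> Upair j k \<in># E} \<le> card (set_mset {#e \<in># E. k \<in> set_uprod e#})"
    by (rule card_inj_on_le[where f = "\<lambda>j. Upair j k"]) (auto simp: inj_on_def)
  also have "\<dots> \<le> mg_degree E k"
    unfolding mg_degree_def by (metis mset_set_set_mset_msubset size_mset_mono size_mset_set)
  finally have "card {j\<in>V. j \<noteq> k \<and> Upair j k \<in># E} \<le> mg_degree E k" .
  moreover have "{j\<in>V. j = k \<or> Upair j k \<in># E} \<subseteq> insert k {j\<in>V. j \<noteq> k \<and> Upair j k \<in># E}"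
    by auto
  then have "card {j\<in>V. j = k \<or> Upair j k \<in># E} \<le> card (insert k {j\<in>V. j \<noteq> k \<and> Upair j k \<in># E})"
    using assms by (intro card_mono) auto
  moreover have "\<dots> \<le> Suc (card {j\<in>V. j \<noteq> k \<and> Upair j k \<in># E})"
    by (rule card_insert_le_m1) auto
  ultimately show ?thesis by linarith
qed

lemma dependency_graphD:
  assumes "dependency_graph M V X E" "V1 \<subseteq> V" "V2 \<subseteq> V" "V1 \<inter> V2 = {}"
    "\<And>a b. a \<in> V1 \<Longrightarrow> b \<in> V2 \<Longrightarrow> Upair a b \<notin># E"
  shows "prob_space.indep_var M (PiM V1 (\<lambda>_. borel)) (\<lambda>\<omega>. \<lambda>k\<in>V1. X k \<omega>)
         (PiM V2 (\<lambda>_. borel)) (\<lambda>\<omega>. \<lambda>k\<in>V2. X k \<omega>)"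
  using assms(1)[unfolded dependency_graph_def, THEN conjunct2, rule_format, OF assms(2-4)] assms(5)
  by simp

lemma dependency_graph_affine:
  fixes Y :: "'a \<Rightarrow> 'w \<Rightarrow> real"
  assumes "prob_space M" "dependency_graph M V Y E"
  shows "dependency_graph M V (\<lambda>k \<omega>. (Y k \<omega> - b k) / s) E"
proof -
  interpret prob_space M by fact
  let ?g = "\<lambda>U x. \<lambda>k\<in>U. (x k - b k) / s"
  have g: "?g U \<in> measurable (PiM U (\<lambda>_. borel)) (PiM U (\<lambda>_. borel))" for U
    by measurable
  have "indep_var (PiM V1 (\<lambda>_. borel)) (\<lambda>\<omega>. \<lambda>k\<in>V1. (Y k \<omega> - b k) / s)
         (PiM V2 (\<lambda>_. borel)) (\<lambda>\<omega>. \<lambda>k\<in>V2. (Y k \<omega> - b k) / s)"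
    if "indep_var (PiM V1 (\<lambda>_. borel)) (\<lambda>\<omega>. \<lambda>k\<in>V1. Y k \<omega>)
         (PiM V2 (\<lambda>_. borel)) (\<lambda>\<omega>. \<lambda>k\<in>V2. Y k \<omega>)" for V1 V2
  proof -
    have "?g U \<circ> (\<lambda>\<omega>. \<lambda>k\<in>U. Y k \<omega>) = (\<lambda>\<omega>. \<lambda>k\<in>U. (Y k \<omega> - b k) / s)" for U
      by (auto simp: fun_eq_iff restrict_def)
    then show ?thesis
      using indep_var_compose[OF that g g] by simp
  qed
  then show ?thesis
    using assms(2) dependency_graphD[OF assms(2)] unfolding dependency_graph_def
    by (intro conjI allI impI) auto
qed

text \<open>
  The setting to which Stein's method applies, after each summand has been centred and divided by the standard
  deviation of the sum.
\<close>

locale centred_local_dependence = prob_space M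
  for M :: "'w measure" +
  fixes V :: "'a set" and X :: "'a \<Rightarrow> 'w \<Rightarrow> real" and E :: "'a uprod multiset"
    and D :: nat and \<delta> :: real
  assumes finite_V: "finite V"
    and dependent: "dependency_graph M V X E"
    and degree: "\<And>k. k \<in> V \<Longrightarrow> mg_degree E k \<le> D"
    and rv [measurable]: "\<And>k. k \<in> V \<Longrightarrow> X k \<in> borel_measurable M"
    and square: "\<And>k. k \<in> V \<Longrightarrow> integrable M (\<lambda>\<omega>. (X k \<omega>)\<^sup>2)"
    and centred: "\<And>k. k \<in> V \<Longrightarrow> expectation (X k) = 0"
    and moment: "\<And>k. k \<in> V \<Longrightarrow> integrable M (\<lambda>\<omega>. \<bar>X k \<omega>\<bar> powr \<delta>)"
    and \<delta>: "2 < \<delta>" "\<delta> < 3"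
    and unit_variance: "expectation (\<lambda>\<omega>. (\<Sum>k\<in>V. X k \<omega>)\<^sup>2) = 1"
begin

definition nb :: "'a \<Rightarrow> 'a set" where
  "nb k = {j\<in>V. j = k \<or> Upair j k \<in># E}"

definition psum :: "'a set \<Rightarrow> 'w \<Rightarrow> real" where
  "psum B \<omega> = (\<Sum>l\<in>B. X l \<omega>)"

definition abs_moment :: "'a \<Rightarrow> real" where
  "abs_moment k = expectation (\<lambda>\<omega>. \<bar>X k \<omega>\<bar> powr \<delta>)"

abbreviation W :: "'w \<Rightarrow> real" where
  "W \<equiv> psum V"

abbreviation \<Delta> :: real where
  "\<Delta> \<equiv> real D + 1"

text \<open>
  The order of magnitude of $\mathbb{E}[W f(W) - f'(W)]$ for test functions \<open>f\<close> whose derivative is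
  Hoelder continuous of order \<open>\<delta> - 2\<close>.
\<close>

definition stein_error :: real where
  "stein_error = \<Delta> powr (\<delta> - 1) * (\<Sum>k\<in>V. abs_moment k)"

lemma nb_subset: "nb k \<subseteq> V"
  by (auto simp: nb_def)

lemma finite_nb [simp]: "finite (nb k)"
  using nb_subset finite_V finite_subset by blast

lemma nb_sym: "k \<in> V \<Longrightarrow> j \<in> nb k \<longleftrightarrow> j \<in> V \<and> k \<in> nb j"
proof -
  have "Upair j k = Upair k j" by simp
  then show "k \<in> V \<Longrightarrow> j \<in> nb k \<longleftrightarrow> j \<in> V \<and> k \<in> nb j"
    unfolding nb_def by (metis (mono_tags, lifting) mem_Collect_eq)
qed

lemma card_nb: "k \<in> V \<Longrightarrow> real (card (nb k)) \<le> \<Delta>"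
  using card_neighbours_le_degree[OF finite_V, of k E] degree[of k] unfolding nb_def by linarith

lemma measurable_psum [measurable]: "B \<subseteq> V \<Longrightarrow> psum B \<in> borel_measurable M"
  unfolding psum_def using rv by (intro borel_measurable_sum) auto

lemma psum_split: "B \<subseteq> V \<Longrightarrow> W \<omega> = psum (V - B) \<omega> + psum B \<omega>"
  unfolding psum_def using finite_V by (simp add: sum.subset_diff)

lemma abs_moment_nonneg: "0 \<le> abs_moment k"
  by (simp add: abs_moment_def)

lemma stein_error_nonneg: "0 \<le> stein_error"
  by (simp add: stein_error_def sum_nonneg abs_moment_nonneg)

lemma integrable_X: "k \<in> V \<Longrightarrow> integrable M (X k)"
  using square_integrable_imp_integrable rv square by blast

lemma integrable_XX:
  assumes "k \<in> V" "j \<in> V"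
  shows "integrable M (\<lambda>\<omega>. X k \<omega> * X j \<omega>)"
proof (rule Bochner_Integration.integrable_bound)
  show "integrable M (\<lambda>\<omega>. (X k \<omega>)\<^sup>2 + (X j \<omega>)\<^sup>2)"
    using assms square by auto
  show "AE \<omega> in M. norm (X k \<omega> * X j \<omega>) \<le> norm ((X k \<omega>)\<^sup>2 + (X j \<omega>)\<^sup>2)"
  proof (rule AE_I2)
    fix \<omega>
    have "2 * (\<bar>X k \<omega>\<bar> * \<bar>X j \<omega>\<bar>) \<le> (X k \<omega>)\<^sup>2 + (X j \<omega>)\<^sup>2"
      using sum_squares_bound[of "\<bar>X k \<omega>\<bar>" "\<bar>X j \<omega>\<bar>"] by simp
    moreover have "0 \<le> \<bar>X k \<omega>\<bar> * \<bar>X j \<omega>\<bar>" by simp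
    ultimately show "norm (X k \<omega> * X j \<omega>) \<le> norm ((X k \<omega>)\<^sup>2 + (X j \<omega>)\<^sup>2)"
      unfolding real_norm_def abs_mult by linarith
  qed
  show "(\<lambda>\<omega>. X k \<omega> * X j \<omega>) \<in> borel_measurable M"
    using assms by measurable
qed

text \<open>
  No edge joins \<open>U\<close> to the complement of the closed neighbourhoods of its elements, and that complement is
  disjoint from \<open>U\<close>.
\<close>

lemma indep_outside:
  assumes "U \<subseteq> V" "g \<in> borel_measurable (PiM U (\<lambda>_. borel))"
  shows "indep_var borel (\<lambda>\<omega>. g (\<lambda>i\<in>U. X i \<omega>)) borel (psum (V - (\<Union>u\<in>U. nb u)))"
proof -
  define B where "B = V - (\<Union>u\<in>U. nb u)"
  have "indep_var (PiM U (\<lambda>_. borel)) (\<lambda>\<omega>. \<lambda>k\<in>U. X k \<omega>)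
         (PiM B (\<lambda>_. borel)) (\<lambda>\<omega>. \<lambda>k\<in>B. X k \<omega>)"
  proof -
    have "U \<inter> B = {}" using assms by (auto simp: B_def nb_def)
    moreover have "Upair a b \<notin># E" if "a \<in> U" "b \<in> B" for a b
    proof -
      have "Upair b a \<notin># E" using that by (auto simp: B_def nb_def)
      moreover have "Upair a b = Upair b a" by simp
      ultimately show ?thesis by metis
    qed
    moreover have "B \<subseteq> V" by (auto simp: B_def)
    ultimately show ?thesis
      using assms(1) by (intro dependency_graphD[OF dependent]) auto
  qed
  moreover have "(\<lambda>x. \<Sum>l\<in>B. x l) \<in> borel_measurable (PiM B (\<lambda>_. borel :: real measure))"
    by (intro borel_measurable_sum) measurable
  ultimately have "indep_var borel (g \<circ> (\<lambda>\<omega>. \<lambda>k\<in>U. X k \<omega>))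
      borel ((\<lambda>x. \<Sum>l\<in>B. x l) \<circ> (\<lambda>\<omega>. \<lambda>k\<in>B. X k \<omega>))"
    using assms(2) by (intro indep_var_compose) auto
  moreover have "(\<lambda>x. \<Sum>l\<in>B. x l) \<circ> (\<lambda>\<omega>. \<lambda>k\<in>B. X k \<omega>) = psum B"
    by (auto simp: psum_def fun_eq_iff)
  ultimately show ?thesis
    by (simp add: comp_def B_def)
qed

lemma indep_one:
  assumes "k \<in> V"
  shows "indep_var borel (X k) borel (psum (V - nb k))"
  using indep_outside[of "{k}" "\<lambda>x. x k"] assms by simp

lemma indep_two:
  assumes "k \<in> V" "j \<in> V"
  shows "indep_var borel (\<lambda>\<omega>. X k \<omega> * X j \<omega>) borel (psum (V - (nb k \<union> nb j)))"
  using indep_outside[of "{k, j}" "\<lambda>x. x k * x j"] assms by simp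

lemma expectation_one_outside:
  assumes "k \<in> V" "f \<in> borel_measurable borel" "integrable M (\<lambda>\<omega>. f (psum (V - nb k) \<omega>))"
  shows "integrable M (\<lambda>\<omega>. X k \<omega> * f (psum (V - nb k) \<omega>))"
    and "expectation (\<lambda>\<omega>. X k \<omega> * f (psum (V - nb k) \<omega>)) = 0"
proof -
  have "indep_var borel ((\<lambda>x. x) \<circ> X k) borel (f \<circ> psum (V - nb k))"
    using assms by (intro indep_var_compose[OF indep_one]) auto
  then have "indep_var borel (X k) borel (\<lambda>\<omega>. f (psum (V - nb k) \<omega>))"
    by (simp add: comp_def)
  from indep_var_integrable[OF this] indep_var_lebesgue_integral[OF this]
  show "integrable M (\<lambda>\<omega>. X k \<omega> * f (psum (V - nb k) \<omega>))"
    and "expectation (\<lambda>\<omega>. X k \<omega> * f (psum (V - nb k) \<omega>)) = 0"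
    using assms integrable_X centred by auto
qed

lemma expectation_two_outside:
  assumes "k \<in> V" "j \<in> V" "f \<in> borel_measurable borel"
    "integrable M (\<lambda>\<omega>. f (psum (V - (nb k \<union> nb j)) \<omega>))"
  shows "integrable M (\<lambda>\<omega>. X k \<omega> * X j \<omega> * f (psum (V - (nb k \<union> nb j)) \<omega>))"
    and "expectation (\<lambda>\<omega>. X k \<omega> * X j \<omega> * f (psum (V - (nb k \<union> nb j)) \<omega>))
      = expectation (\<lambda>\<omega>. X k \<omega> * X j \<omega>) * expectation (\<lambda>\<omega>. f (psum (V - (nb k \<union> nb j)) \<omega>))"
proof -
  have "indep_var borel ((\<lambda>x. x) \<circ> (\<lambda>\<omega>. X k \<omega> * X j \<omega>)) borel (f \<circ> psum (V - (nb k \<union> nb j)))"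
    using assms by (intro indep_var_compose[OF indep_two]) auto
  then have "indep_var borel (\<lambda>\<omega>. X k \<omega> * X j \<omega>) borel (\<lambda>\<omega>. f (psum (V - (nb k \<union> nb j)) \<omega>))"
    by (simp add: comp_def)
  from indep_var_integrable[OF this] indep_var_lebesgue_integral[OF this]
  show "integrable M (\<lambda>\<omega>. X k \<omega> * X j \<omega> * f (psum (V - (nb k \<union> nb j)) \<omega>))"
    and "expectation (\<lambda>\<omega>. X k \<omega> * X j \<omega> * f (psum (V - (nb k \<union> nb j)) \<omega>))
      = expectation (\<lambda>\<omega>. X k \<omega> * X j \<omega>) * expectation (\<lambda>\<omega>. f (psum (V - (nb k \<union> nb j)) \<omega>))"
    using assms integrable_XX by auto
qed

lemma integrable_psum: "B \<subseteq> V \<Longrightarrow> integrable M (psum B)"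
  unfolding psum_def using integrable_X by (intro Bochner_Integration.integrable_sum) auto

text \<open>
  Pairs that are not neighbours are uncorrelated, so the sum is the variance of \<open>W\<close>.
\<close>

lemma sum_neighbour_covariances:
  "(\<Sum>k\<in>V. \<Sum>j\<in>nb k. expectation (\<lambda>\<omega>. X k \<omega> * X j \<omega>)) = 1"
proof -
  have k: "expectation (\<lambda>\<omega>. X k \<omega> * W \<omega>) = (\<Sum>j\<in>nb k. expectation (\<lambda>\<omega>. X k \<omega> * X j \<omega>))"
    and ki: "integrable M (\<lambda>\<omega>. X k \<omega> * W \<omega>)" if "k \<in> V" for k
  proof -
    have i: "integrable M (\<lambda>\<omega>. X k \<omega> * psum B \<omega>)" if "B \<subseteq> V" for B
      unfolding psum_def sum_distrib_left
      using that \<open>k \<in> V\<close> integrable_XX by (intro Bochner_Integration.integrable_sum) auto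
    then show "integrable M (\<lambda>\<omega>. X k \<omega> * W \<omega>)" by simp
    have "expectation (\<lambda>\<omega>. X k \<omega> * W \<omega>)
        = expectation (\<lambda>\<omega>. X k \<omega> * psum (V - nb k) \<omega> + X k \<omega> * psum (nb k) \<omega>)"
      by (simp add: psum_split[OF nb_subset, of _ k] distrib_left)
    also have "\<dots> = expectation (\<lambda>\<omega>. X k \<omega> * psum (nb k) \<omega>)"
      using expectation_one_outside(2)[OF that, of "\<lambda>x. x"] integrable_psum[of "V - nb k"]
        i[of "V - nb k"] i[OF nb_subset] by auto
    also have "\<dots> = (\<Sum>j\<in>nb k. expectation (\<lambda>\<omega>. X k \<omega> * X j \<omega>))"
      unfolding psum_def sum_distrib_left
      using that nb_subset integrable_XX by (intro Bochner_Integration.integral_sum) auto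
    finally show "expectation (\<lambda>\<omega>. X k \<omega> * W \<omega>) = (\<Sum>j\<in>nb k. expectation (\<lambda>\<omega>. X k \<omega> * X j \<omega>))" .
  qed
  have "1 = expectation (\<lambda>\<omega>. \<Sum>k\<in>V. X k \<omega> * W \<omega>)"
    using unit_variance by (simp add: psum_def power2_eq_square sum_distrib_right)
  also have "\<dots> = (\<Sum>k\<in>V. expectation (\<lambda>\<omega>. X k \<omega> * W \<omega>))"
    using ki by (intro Bochner_Integration.integral_sum)
  finally show ?thesis using k by simp
qed

end

section \<open>The Stein operator under local dependence\<close>

text \<open>
  On the ball of radius \<open>\<bar>z\<bar>\<close> around \<open>y + z\<close> the function \<open>x \<mapsto> f x - x * f' (y + z)\<close> has derivative at most
  \<open>H * \<bar>z\<bar> powr p\<close>.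
\<close>

lemma first_order_remainder_le:
  fixes f f' :: "real \<Rightarrow> real"
  assumes df: "\<And>x. (f has_real_derivative f' x) (at x)"
    and hoelder: "\<And>x y. \<bar>f' x - f' y\<bar> \<le> H * \<bar>x - y\<bar> powr p"
    and "0 \<le> H" "0 \<le> p"
  shows "\<bar>f (y + z) - f y - z * f' (y + z)\<bar> \<le> H * \<bar>z\<bar> powr (p + 1)"
proof -
  let ?w = "y + z"
  have "norm ((f ?w - ?w * f' ?w) - (f y - y * f' ?w)) \<le> H * \<bar>z\<bar> powr p * norm (?w - y)"
  proof (rule field_differentiable_bound[where S = "cball ?w \<bar>z\<bar>"])
    show "((\<lambda>x. f x - x * f' ?w) has_field_derivative (f' x - f' ?w)) (at x within cball ?w \<bar>z\<bar>)" for x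
      by (auto intro!: derivative_eq_intros DERIV_subset[OF df])
    show "norm (f' x - f' ?w) \<le> H * \<bar>z\<bar> powr p" if "x \<in> cball ?w \<bar>z\<bar>" for x
    proof -
      have "\<bar>x - ?w\<bar> powr p \<le> \<bar>z\<bar> powr p"
        using that assms by (intro powr_mono2) (auto simp: dist_real_def abs_minus_commute)
      with hoelder[of x ?w] \<open>0 \<le> H\<close> show ?thesis
        by (smt (verit) mult_left_mono real_norm_def)
    qed
  qed (auto simp: dist_real_def)
  also have "\<dots> = H * \<bar>z\<bar> powr (p + 1)"
    by (cases "z = 0") (auto simp: powr_add)
  finally show ?thesis by (simp add: algebra_simps)
qed

lemma (in prob_space) abs_expectation_le:
  fixes g G :: "'a \<Rightarrow> real"
  assumes "g \<in> borel_measurable M" "integrable M G" "\<And>\<omega>. \<omega> \<in> space M \<Longrightarrow> \<bar>g \<omega>\<bar> \<le> G \<omega>"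
  shows "integrable M g" "\<bar>expectation g\<bar> \<le> expectation G"
proof -
  show "integrable M g"
    using assms by (intro Bochner_Integration.integrable_bound[OF assms(2) assms(1)] AE_I2)
      (auto intro: order_trans[OF _ abs_ge_self])
  then have "expectation (\<lambda>\<omega>. \<bar>g \<omega>\<bar>) \<le> expectation G"
    using assms by (intro integral_mono) auto
  then show "\<bar>expectation g\<bar> \<le> expectation G"
    using integral_abs_bound[of M g] by linarith
qed

context centred_local_dependence
begin

lemma
  assumes "finite B" "B \<subseteq> V"
  shows integrable_moment_sum: "integrable M (\<lambda>\<omega>. \<Sum>l\<in>B. \<bar>X l \<omega>\<bar> powr \<delta>)"
    and expectation_moment_sum:
      "expectation (\<lambda>\<omega>. \<Sum>l\<in>B. \<bar>X l \<omega>\<bar> powr \<delta>) = (\<Sum>l\<in>B. abs_moment l)"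
  using assms moment unfolding abs_moment_def
  by (auto intro!: Bochner_Integration.integrable_sum Bochner_Integration.integral_sum)

text \<open>
  Each vertex is counted once for each element of its neighbourhood. The second inequality exchanges the sums
  and uses that being neighbours is a symmetric relation.
\<close>

lemma sum_over_neighbours:
  assumes "\<And>k. k \<in> V \<Longrightarrow> 0 \<le> (a k :: real)"
  shows "(\<Sum>k\<in>V. \<Sum>j\<in>nb k. a k) \<le> \<Delta> * (\<Sum>k\<in>V. a k)"
    and "(\<Sum>k\<in>V. \<Sum>j\<in>nb k. a j) \<le> \<Delta> * (\<Sum>k\<in>V. a k)"
proof -
  show 1: "(\<Sum>k\<in>V. \<Sum>j\<in>nb k. a k) \<le> \<Delta> * (\<Sum>k\<in>V. a k)"
    unfolding sum_distrib_left using card_nb assms by (auto intro!: sum_mono mult_right_mono)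
  have nb: "nb k = {j\<in>V. j \<in> nb k}" for k using nb_subset by auto
  have "(\<Sum>k\<in>V. \<Sum>j\<in>nb k. a j) = (\<Sum>k\<in>V. \<Sum>j\<in>{j\<in>V. j \<in> nb k}. a j)"
    using nb by simp
  also have "\<dots> = (\<Sum>j\<in>V. \<Sum>k\<in>{k\<in>V. j \<in> nb k}. a j)"
    using finite_V by (rule sum.swap_restrict[OF _ finite_V])
  also have "\<dots> = (\<Sum>j\<in>V. \<Sum>k\<in>nb j. a j)"
  proof (rule sum.cong[OF refl])
    fix j assume "j \<in> V"
    then have "{k\<in>V. j \<in> nb k} = nb j" using nb_sym nb_subset by blast
    then show "(\<Sum>k\<in>{k\<in>V. j \<in> nb k}. a j) = (\<Sum>k\<in>nb j. a j)" by simp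
  qed
  finally show "(\<Sum>k\<in>V. \<Sum>j\<in>nb k. a j) \<le> \<Delta> * (\<Sum>k\<in>V. a k)" using 1 by simp
qed

text \<open>
  The test functions of Stein's method. Boundedness makes the expectations exist, and the
  Hoelder constant of the derivative governs the size of the Stein operator.
\<close>

context
  fixes f f' :: "real \<Rightarrow> real" and b H :: real
  assumes df: "\<And>x. (f has_real_derivative f' x) (at x)"
    and f_le: "\<And>x. \<bar>f x\<bar> \<le> b" and f'_le: "\<And>x. \<bar>f' x\<bar> \<le> b"
    and hoelder: "\<And>x y. \<bar>f' x - f' y\<bar> \<le> H * \<bar>x - y\<bar> powr (\<delta> - 2)"
    and f'_meas [measurable]: "f' \<in> borel_measurable borel"
    and H_nonneg: "0 \<le> H"
begin

lemma f_meas [measurable]: "f \<in> borel_measurable borel"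
  using df by (intro borel_measurable_continuous_onI continuous_at_imp_continuous_on)
    (auto intro: DERIV_isCont)

lemma integrable_bounded:
  assumes "g \<in> borel_measurable M" "h = f \<or> h = f'"
  shows "integrable M (\<lambda>\<omega>. h (g \<omega>))"
  using assms f_le f'_le by (intro integrable_const_bound[where B = b]) auto

lemma integrable_times_bounded:
  assumes "integrable M G" "g \<in> borel_measurable M" "h = f \<or> h = f'"
  shows "integrable M (\<lambda>\<omega>. G \<omega> * h (g \<omega>))"
proof (rule Bochner_Integration.integrable_bound)
  show "integrable M (\<lambda>\<omega>. b * G \<omega>)" using assms by simp
  show "AE \<omega> in M. norm (G \<omega> * h (g \<omega>)) \<le> norm (b * G \<omega>)"
  proof (rule AE_I2)
    fix \<omega>
    have "\<bar>h (g \<omega>)\<bar> \<le> \<bar>b\<bar>" using assms f_le[of "g \<omega>"] f'_le[of "g \<omega>"] by auto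
    then show "norm (G \<omega> * h (g \<omega>)) \<le> norm (b * G \<omega>)"
      unfolding real_norm_def abs_mult mult.commute[of "\<bar>b\<bar>"] by (intro mult_left_mono) auto
  qed
qed (use assms in auto)

text \<open>
  As \<open>X k\<close> is centred and independent of the sum \<open>W\<^sub>k\<close> outside its neighbourhood,
  $\mathbb{E}[X_k f(W)] = \mathbb{E}[X_k (f(W) - f(W_k))]$, and \<open>W - W\<^sub>k\<close> is the sum over the neighbourhood.
\<close>

lemma stein_first_order:
  assumes k: "k \<in> V"
  shows "\<bar>expectation (\<lambda>\<omega>. X k \<omega> * f (W \<omega>)) - (\<Sum>j\<in>nb k. expectation (\<lambda>\<omega>. X k \<omega> * X j \<omega> * f' (W \<omega>)))\<bar>
    \<le> H * \<Delta> powr (\<delta> - 1) * ((abs_moment k + (\<delta> - 1) * ((\<Sum>l\<in>nb k. abs_moment l) / \<Delta>)) / \<delta>)"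
proof -
  note [measurable] = rv[OF k] measurable_psum[of "V - nb k"] measurable_psum[OF nb_subset, of k]
    measurable_psum[OF order_refl]
  let ?Wk = "psum (V - nb k)" and ?Z = "psum (nb k)"
  let ?G = "\<lambda>\<omega>. H * (\<Delta> powr (\<delta> - 1) *
    ((\<bar>X k \<omega>\<bar> powr \<delta> + (\<delta> - 1) * ((\<Sum>l\<in>nb k. \<bar>X l \<omega>\<bar> powr \<delta>) / \<Delta>)) / \<delta>))"
  let ?g = "\<lambda>\<omega>. X k \<omega> * (f (W \<omega>) - f (?Wk \<omega>) - ?Z \<omega> * f' (W \<omega>))"
  have ij: "integrable M (\<lambda>\<omega>. X k \<omega> * X j \<omega> * f' (W \<omega>))" if "j \<in> nb k" for j
    using that k nb_subset by (intro integrable_times_bounded integrable_XX) auto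
  have i: "integrable M (\<lambda>\<omega>. X k \<omega> * f (W \<omega>))" "integrable M (\<lambda>\<omega>. X k \<omega> * f (?Wk \<omega>))"
    using k by (auto intro!: integrable_times_bounded[where h = f] integrable_X)
  have "expectation ?g = expectation (\<lambda>\<omega>. X k \<omega> * f (W \<omega>) - X k \<omega> * f (?Wk \<omega>)
      - (\<Sum>j\<in>nb k. X k \<omega> * X j \<omega> * f' (W \<omega>)))"
    by (simp add: psum_def algebra_simps sum_distrib_left sum_distrib_right)
  also have "\<dots> = expectation (\<lambda>\<omega>. X k \<omega> * f (W \<omega>))
      - (\<Sum>j\<in>nb k. expectation (\<lambda>\<omega>. X k \<omega> * X j \<omega> * f' (W \<omega>)))"
    using i ij expectation_one_outside(2)[OF k, of f] integrable_bounded[of ?Wk f]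
    by (simp add: Bochner_Integration.integral_sum)
  finally have difference: "expectation (\<lambda>\<omega>. X k \<omega> * f (W \<omega>))
      - (\<Sum>j\<in>nb k. expectation (\<lambda>\<omega>. X k \<omega> * X j \<omega> * f' (W \<omega>))) = expectation ?g" by simp
  have "\<bar>expectation ?g\<bar> \<le> expectation ?G"
  proof (rule abs_expectation_le)
    show "integrable M ?G"
      using moment[OF k] integrable_moment_sum[OF finite_nb nb_subset, of k] by auto
    fix \<omega> assume "\<omega> \<in> space M"
    have "\<bar>f (W \<omega>) - f (?Wk \<omega>) - ?Z \<omega> * f' (W \<omega>)\<bar> \<le> H * \<bar>?Z \<omega>\<bar> powr (\<delta> - 1)"
      using first_order_remainder_le[OF df hoelder H_nonneg, of "?Wk \<omega>" "?Z \<omega>"] \<delta>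
      by (simp add: psum_split[OF nb_subset, of _ k])
    then have "\<bar>?g \<omega>\<bar> \<le> \<bar>X k \<omega>\<bar> * (H * \<bar>?Z \<omega>\<bar> powr (\<delta> - 1))"
      unfolding abs_mult by (rule mult_left_mono) auto
    also have "\<dots> = H * (\<bar>X k \<omega>\<bar> * \<bar>\<Sum>l\<in>nb k. X l \<omega>\<bar> powr (\<delta> - 1))"
      by (simp add: psum_def)
    also have "\<dots> \<le> ?G \<omega>"
      using mixed_moment_two[OF finite_nb card_nb[OF k], of \<delta> "\<bar>X k \<omega>\<bar>" "\<lambda>l. X l \<omega>"] \<delta> H_nonneg
      by (intro mult_left_mono) auto
    finally show "\<bar>?g \<omega>\<bar> \<le> ?G \<omega>" .
  qed measurable
  also have "expectation ?G =
      H * \<Delta> powr (\<delta> - 1) * ((abs_moment k + (\<delta> - 1) * ((\<Sum>l\<in>nb k. abs_moment l) / \<Delta>)) / \<delta>)"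
    using moment[OF k] integrable_moment_sum[OF finite_nb nb_subset, of k]
      expectation_moment_sum[OF finite_nb nb_subset, of k]
    by (simp add: abs_moment_def)
  finally show ?thesis unfolding difference .
qed

text \<open>
  Let \<open>W'\<close> be the sum outside both neighbourhoods, which is independent of \<open>X k * X j\<close>. Replacing \<open>W\<close> by \<open>W'\<close>
  makes the expectation factorise, and replacing \<open>W'\<close> by \<open>W\<close> in the factor $\mathbb{E}[f'(W')]$ costs at most
  as much again. Both replacements follow from one pointwise inequality, in which the product \<open>X k * X j\<close> and the
  increment of \<open>f'\<close> are evaluated at points \<open>\<omega>\<close> and \<open>\<omega>'\<close>: the first takes \<open>\<omega> = \<omega>'\<close>, the second integrates
  over \<open>\<omega>\<close> and \<open>\<omega>'\<close> separately.
\<close>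

lemma stein_second_order:
  assumes k: "k \<in> V" and j: "j \<in> V"
  shows "\<bar>expectation (\<lambda>\<omega>. X k \<omega> * X j \<omega> * f' (W \<omega>))
      - expectation (\<lambda>\<omega>. X k \<omega> * X j \<omega>) * expectation (\<lambda>\<omega>. f' (W \<omega>))\<bar>
    \<le> 2 * (H * (2 * \<Delta>) powr (\<delta> - 2) * ((abs_moment k + abs_moment j
        + (\<delta> - 2) * ((\<Sum>l\<in>nb k \<union> nb j. abs_moment l) / (2 * \<Delta>))) / \<delta>))"
proof -
  define N where "N = nb k \<union> nb j"
  have N: "finite N" "N \<subseteq> V" using nb_subset by (auto simp: N_def)
  have card_N: "real (card N) \<le> 2 * \<Delta>"
  proof -
    have "real (card N) \<le> real (card (nb k)) + real (card (nb j))"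
      unfolding N_def of_nat_add[symmetric] of_nat_le_iff by (rule card_Un_le)
    with card_nb[OF k] card_nb[OF j] show ?thesis by simp
  qed
  note [measurable] = rv[OF k] rv[OF j] measurable_psum[of "V - N"] measurable_psum[OF N(2)]
    measurable_psum[OF order_refl]
  let ?Wk = "psum (V - N)"
  let ?xx = "\<lambda>\<omega>. X k \<omega> * X j \<omega>"
  let ?G = "\<lambda>\<omega> \<omega>'. H * ((2 * \<Delta>) powr (\<delta> - 2) * ((\<bar>X k \<omega>\<bar> powr \<delta> + \<bar>X j \<omega>\<bar> powr \<delta>
    + (\<delta> - 2) * ((\<Sum>l\<in>N. \<bar>X l \<omega>'\<bar> powr \<delta>) / (2 * \<Delta>))) / \<delta>))"
  define R where "R = H * (2 * \<Delta>) powr (\<delta> - 2) * ((abs_moment k + abs_moment j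
        + (\<delta> - 2) * ((\<Sum>l\<in>N. abs_moment l) / (2 * \<Delta>))) / \<delta>)"
  have pointwise: "\<bar>?xx \<omega>\<bar> * \<bar>f' (W \<omega>') - f' (?Wk \<omega>')\<bar> \<le> ?G \<omega> \<omega>'" for \<omega> \<omega>'
  proof -
    have "\<bar>f' (W \<omega>') - f' (?Wk \<omega>')\<bar> \<le> H * \<bar>psum N \<omega>'\<bar> powr (\<delta> - 2)"
      using hoelder[of "W \<omega>'" "?Wk \<omega>'"] by (simp add: psum_split[OF N(2)])
    then have "\<bar>?xx \<omega>\<bar> * \<bar>f' (W \<omega>') - f' (?Wk \<omega>')\<bar>
        \<le> \<bar>?xx \<omega>\<bar> * (H * \<bar>psum N \<omega>'\<bar> powr (\<delta> - 2))"
      by (rule mult_left_mono) auto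
    also have "\<dots> = H * (\<bar>X k \<omega>\<bar> * \<bar>X j \<omega>\<bar> * \<bar>\<Sum>l\<in>N. X l \<omega>'\<bar> powr (\<delta> - 2))"
      by (simp add: psum_def abs_mult)
    also have "\<dots> \<le> ?G \<omega> \<omega>'"
      using mixed_moment_three[OF N(1) card_N, of \<delta> "\<bar>X k \<omega>\<bar>" "\<bar>X j \<omega>\<bar>" "\<lambda>l. X l \<omega>'"] \<delta> H_nonneg
      by (intro mult_left_mono) auto
    finally show ?thesis .
  qed
  have i: "integrable M (\<lambda>\<omega>. ?xx \<omega> * f' (W \<omega>))" "integrable M (\<lambda>\<omega>. ?xx \<omega> * f' (?Wk \<omega>))"
    "integrable M ?xx" "integrable M (\<lambda>\<omega>. f' (W \<omega>))" "integrable M (\<lambda>\<omega>. f' (?Wk \<omega>))"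
    using k j by (auto intro!: integrable_times_bounded[where h = f'] integrable_XX
      integrable_bounded[where h = f'])
  have iG: "integrable M (\<lambda>\<omega>. \<bar>X k \<omega>\<bar> powr \<delta>)" "integrable M (\<lambda>\<omega>. \<bar>X j \<omega>\<bar> powr \<delta>)"
    "integrable M (\<lambda>\<omega>. \<Sum>l\<in>N. \<bar>X l \<omega>\<bar> powr \<delta>)"
    using moment k j integrable_moment_sum[OF N] by auto
  \<comment> \<open>\<open>\<omega> = \<omega>'\<close>: the replacement inside the joint expectation\<close>
  have "\<bar>expectation (\<lambda>\<omega>. ?xx \<omega> * (f' (W \<omega>) - f' (?Wk \<omega>)))\<bar> \<le> expectation (\<lambda>\<omega>. ?G \<omega> \<omega>)"
  proof (rule abs_expectation_le)
    show "integrable M (\<lambda>\<omega>. ?G \<omega> \<omega>)" using iG by auto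
    show "\<bar>?xx \<omega> * (f' (W \<omega>) - f' (?Wk \<omega>))\<bar> \<le> ?G \<omega> \<omega>" for \<omega>
      using pointwise[of \<omega> \<omega>] by (simp only: abs_mult)
  qed measurable
  also have "expectation (\<lambda>\<omega>. ?G \<omega> \<omega>) = R"
    using iG expectation_moment_sum[OF N] by (simp add: abs_moment_def R_def)
  finally have 1: "\<bar>expectation (\<lambda>\<omega>. ?xx \<omega> * f' (W \<omega>)) - expectation (\<lambda>\<omega>. ?xx \<omega> * f' (?Wk \<omega>))\<bar> \<le> R"
    using i by (simp add: right_diff_distrib)
  \<comment> \<open>\<open>\<omega>\<close> and \<open>\<omega>'\<close> separate: first \<open>\<omega>'\<close> is integrated out, then \<open>\<omega>\<close>\<close>
  have "\<bar>?xx \<omega>\<bar> * \<bar>expectation (\<lambda>\<omega>'. f' (W \<omega>') - f' (?Wk \<omega>'))\<bar>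
      \<le> H * (2 * \<Delta>) powr (\<delta> - 2) * ((\<bar>X k \<omega>\<bar> powr \<delta> + \<bar>X j \<omega>\<bar> powr \<delta>
        + (\<delta> - 2) * ((\<Sum>l\<in>N. abs_moment l) / (2 * \<Delta>))) / \<delta>)" for \<omega>
  proof -
    have "\<bar>expectation (\<lambda>\<omega>'. ?xx \<omega> * (f' (W \<omega>') - f' (?Wk \<omega>')))\<bar> \<le> expectation (\<lambda>\<omega>'. ?G \<omega> \<omega>')"
    proof (rule abs_expectation_le)
      show "integrable M (\<lambda>\<omega>'. ?G \<omega> \<omega>')" using iG by auto
      show "\<bar>?xx \<omega> * (f' (W \<omega>') - f' (?Wk \<omega>'))\<bar> \<le> ?G \<omega> \<omega>'" for \<omega>'
        using pointwise[of \<omega> \<omega>'] by (simp only: abs_mult)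
    qed measurable
    then show ?thesis
      using iG expectation_moment_sum[OF N] by (simp add: abs_mult prob_space)
  qed
  note pointwise_mean = this
  have "\<bar>expectation (\<lambda>\<omega>. ?xx \<omega> * expectation (\<lambda>\<omega>'. f' (W \<omega>') - f' (?Wk \<omega>')))\<bar>
      \<le> expectation (\<lambda>\<omega>. H * (2 * \<Delta>) powr (\<delta> - 2) * ((\<bar>X k \<omega>\<bar> powr \<delta> + \<bar>X j \<omega>\<bar> powr \<delta>
        + (\<delta> - 2) * ((\<Sum>l\<in>N. abs_moment l) / (2 * \<Delta>))) / \<delta>))"
  proof (rule abs_expectation_le)
    show "integrable M (\<lambda>\<omega>. H * (2 * \<Delta>) powr (\<delta> - 2) * ((\<bar>X k \<omega>\<bar> powr \<delta> + \<bar>X j \<omega>\<bar> powr \<delta>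
        + (\<delta> - 2) * ((\<Sum>l\<in>N. abs_moment l) / (2 * \<Delta>))) / \<delta>))"
      using iG by auto
    show "\<bar>?xx \<omega> * expectation (\<lambda>\<omega>'. f' (W \<omega>') - f' (?Wk \<omega>'))\<bar>
      \<le> H * (2 * \<Delta>) powr (\<delta> - 2) * ((\<bar>X k \<omega>\<bar> powr \<delta> + \<bar>X j \<omega>\<bar> powr \<delta>
        + (\<delta> - 2) * ((\<Sum>l\<in>N. abs_moment l) / (2 * \<Delta>))) / \<delta>)" for \<omega>
      using pointwise_mean[of \<omega>] by (simp only: abs_mult)
  qed measurable
  also have "\<dots> = R"
    using iG by (simp add: abs_moment_def R_def prob_space)
  finally have 2: "\<bar>expectation ?xx * expectation (\<lambda>\<omega>. f' (W \<omega>))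
      - expectation ?xx * expectation (\<lambda>\<omega>. f' (?Wk \<omega>))\<bar> \<le> R"
    using i by (simp add: right_diff_distrib)
  have "expectation (\<lambda>\<omega>. ?xx \<omega> * f' (?Wk \<omega>)) = expectation ?xx * expectation (\<lambda>\<omega>. f' (?Wk \<omega>))"
    using expectation_two_outside(2)[OF k j f'_meas] i(5) by (simp add: N_def)
  with 1 2 show ?thesis unfolding R_def N_def by linarith
qed

text \<open>
  Summing the first-order errors over the vertices contributes \<open>H * stein_error\<close>. Each of the two replacements
  of the second order contributes at most \<open>2 powr (\<delta> - 2) \<le> 2\<close> times as much, since the union of two
  neighbourhoods has up to \<open>2 * \<Delta>\<close> elements.
\<close>

lemma stein_bound:
  "\<bar>expectation (\<lambda>\<omega>. W \<omega> * f (W \<omega>) - f' (W \<omega>))\<bar> \<le> 5 * H * stein_error"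
proof -
  note [measurable] = measurable_psum[OF order_refl]
  define s where "s = (\<Sum>k\<in>V. abs_moment k)"
  have s: "0 \<le> s" by (simp add: s_def sum_nonneg abs_moment_nonneg)
  define T where "T k = (\<Sum>l\<in>nb k. abs_moment l)" for k
  have T: "0 \<le> T k" for k by (simp add: T_def sum_nonneg abs_moment_nonneg)
  have sumT: "(\<Sum>k\<in>V. T k) \<le> \<Delta> * s"
    unfolding T_def s_def by (rule sum_over_neighbours) (rule abs_moment_nonneg)
  let ?A = "\<lambda>k. expectation (\<lambda>\<omega>. X k \<omega> * f (W \<omega>))"
  let ?B = "\<lambda>k j. expectation (\<lambda>\<omega>. X k \<omega> * X j \<omega> * f' (W \<omega>))"
  let ?C = "\<lambda>k j. expectation (\<lambda>\<omega>. X k \<omega> * X j \<omega>)"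
  let ?F = "expectation (\<lambda>\<omega>. f' (W \<omega>))"
  have iA: "integrable M (\<lambda>\<omega>. X k \<omega> * f (W \<omega>))" if "k \<in> V" for k
    using that by (auto intro!: integrable_times_bounded[where h = f] integrable_X)
  have "expectation (\<lambda>\<omega>. W \<omega> * f (W \<omega>) - f' (W \<omega>))
      = expectation (\<lambda>\<omega>. (\<Sum>k\<in>V. X k \<omega> * f (W \<omega>)) - f' (W \<omega>))"
    by (simp add: psum_def sum_distrib_right)
  also have "\<dots> = (\<Sum>k\<in>V. ?A k) - ?F"
    using iA integrable_bounded[of W f'] by (simp add: Bochner_Integration.integral_sum)
  also have "\<dots> = (\<Sum>k\<in>V. ?A k) - (\<Sum>k\<in>V. \<Sum>j\<in>nb k. ?C k j) * ?F"
    using sum_neighbour_covariances by simp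
  also have "\<dots> = (\<Sum>k\<in>V. ?A k - (\<Sum>j\<in>nb k. ?B k j))
      + (\<Sum>k\<in>V. \<Sum>j\<in>nb k. ?B k j - ?C k j * ?F)"
    by (simp add: sum_subtractf sum_distrib_right)
  finally have split: "expectation (\<lambda>\<omega>. W \<omega> * f (W \<omega>) - f' (W \<omega>))
      = (\<Sum>k\<in>V. ?A k - (\<Sum>j\<in>nb k. ?B k j)) + (\<Sum>k\<in>V. \<Sum>j\<in>nb k. ?B k j - ?C k j * ?F)" .
  have "\<bar>\<Sum>k\<in>V. ?A k - (\<Sum>j\<in>nb k. ?B k j)\<bar> \<le> (\<Sum>k\<in>V. \<bar>?A k - (\<Sum>j\<in>nb k. ?B k j)\<bar>)"
    by (rule sum_abs)
  also have "\<dots> \<le> (\<Sum>k\<in>V. H * \<Delta> powr (\<delta> - 1) * ((abs_moment k + (\<delta> - 1) * (T k / \<Delta>)) / \<delta>))"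
    unfolding T_def by (intro sum_mono stein_first_order)
  also have "\<dots> = H * \<Delta> powr (\<delta> - 1) * ((s + (\<delta> - 1) * ((\<Sum>k\<in>V. T k) / \<Delta>)) / \<delta>)"
    by (simp add: sum.distrib s_def flip: sum_distrib_left sum_divide_distrib)
  also have "\<dots> \<le> H * \<Delta> powr (\<delta> - 1) * ((s + (\<delta> - 1) * ((\<Delta> * s) / \<Delta>)) / \<delta>)"
    using sumT H_nonneg \<delta>
    by (intro mult_left_mono divide_right_mono add_left_mono) auto
  also have "(\<Delta> * s) / \<Delta> = s" by simp
  also have "H * \<Delta> powr (\<delta> - 1) * ((s + (\<delta> - 1) * s) / \<delta>) = H * \<Delta> powr (\<delta> - 1) * s"
    using \<delta> by (simp add: algebra_simps)
  also have "\<dots> = H * stein_error"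
    by (simp add: stein_error_def s_def)
  finally have first: "\<bar>\<Sum>k\<in>V. ?A k - (\<Sum>j\<in>nb k. ?B k j)\<bar> \<le> H * stein_error" .
  let ?c = "2 * (H * (2 * \<Delta>) powr (\<delta> - 2))"
  have "\<bar>\<Sum>k\<in>V. \<Sum>j\<in>nb k. ?B k j - ?C k j * ?F\<bar> \<le> (\<Sum>k\<in>V. \<Sum>j\<in>nb k. \<bar>?B k j - ?C k j * ?F\<bar>)"
    by (rule order_trans[OF sum_abs sum_mono[OF sum_abs]])
  also have "\<dots> \<le> (\<Sum>k\<in>V. \<Sum>j\<in>nb k. ?c * ((abs_moment k + abs_moment j
      + (\<delta> - 2) * ((T k + T j) / (2 * \<Delta>))) / \<delta>))"
  proof (intro sum_mono)
    fix k j assume k: "k \<in> V" and "j \<in> nb k"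
    then have j: "j \<in> V" using nb_subset by auto
    have "(\<Sum>l\<in>nb k \<union> nb j. abs_moment l) \<le> T k + T j"
      unfolding T_def
      using sum.union_inter[OF finite_nb finite_nb, of abs_moment k j]
        sum_nonneg[of "nb k \<inter> nb j" abs_moment, OF abs_moment_nonneg] by linarith
    then have "?c * ((abs_moment k + abs_moment j
        + (\<delta> - 2) * ((\<Sum>l\<in>nb k \<union> nb j. abs_moment l) / (2 * \<Delta>))) / \<delta>)
      \<le> ?c * ((abs_moment k + abs_moment j + (\<delta> - 2) * ((T k + T j) / (2 * \<Delta>))) / \<delta>)"
      using H_nonneg \<delta>
      by (intro mult_left_mono divide_right_mono add_left_mono) auto
    with stein_second_order[OF k j] show "\<bar>?B k j - ?C k j * ?F\<bar>
        \<le> ?c * ((abs_moment k + abs_moment j + (\<delta> - 2) * ((T k + T j) / (2 * \<Delta>))) / \<delta>)"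
      by (simp only: mult.assoc)
  qed
  also have "\<dots> = ?c * (((\<Sum>k\<in>V. \<Sum>j\<in>nb k. abs_moment k) + (\<Sum>k\<in>V. \<Sum>j\<in>nb k. abs_moment j)
      + (\<delta> - 2) * (((\<Sum>k\<in>V. \<Sum>j\<in>nb k. T k) + (\<Sum>k\<in>V. \<Sum>j\<in>nb k. T j)) / (2 * \<Delta>))) / \<delta>)"
    by (simp only: sum.distrib flip: sum_distrib_left sum_divide_distrib)
  also have "\<dots> \<le> ?c * ((\<Delta> * s + \<Delta> * s + (\<delta> - 2) * ((\<Delta> * (\<Delta> * s) + \<Delta> * (\<Delta> * s)) / (2 * \<Delta>))) / \<delta>)"
  proof -
    have t: "\<Delta> * (\<Sum>k\<in>V. T k) \<le> \<Delta> * (\<Delta> * s)" using sumT by (intro mult_left_mono) auto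
    note sum_over_neighbours[of abs_moment, OF abs_moment_nonneg, folded s_def]
      order_trans[OF sum_over_neighbours(1)[of T, OF T] t]
      order_trans[OF sum_over_neighbours(2)[of T, OF T] t]
    then show ?thesis
      using H_nonneg \<delta>
      by (intro mult_left_mono divide_right_mono add_mono) auto
  qed
  also have "(\<Delta> * (\<Delta> * s) + \<Delta> * (\<Delta> * s)) / (2 * \<Delta>) = \<Delta> * s"
  proof -
    have "(d * (d * s) + d * (d * s)) / (2 * d) = d * s" if "0 < d" for d :: real
      using that by (simp add: field_simps)
    from this[of \<Delta>] show ?thesis by linarith
  qed
  also have "\<Delta> * s + \<Delta> * s + (\<delta> - 2) * (\<Delta> * s) = \<delta> * (\<Delta> * s)"
    by (simp add: algebra_simps)
  also have "\<delta> * (\<Delta> * s) / \<delta> = \<Delta> * s"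
    using \<delta> by simp
  also have "?c * (\<Delta> * s) = 2 * H * 2 powr (\<delta> - 2) * (\<Delta> powr (\<delta> - 2) * \<Delta> * s)"
    by (simp only: powr_mult mult_ac)
  also have "\<Delta> powr (\<delta> - 2) * \<Delta> * s = stein_error"
    using powr_add[of \<Delta> "\<delta> - 2" 1] by (simp add: stein_error_def s_def)
  also have "2 * H * 2 powr (\<delta> - 2) * stein_error \<le> 2 * H * 2 * stein_error"
    using powr_mono[of "\<delta> - 2" 1 2] \<delta> H_nonneg stein_error_nonneg
    by (intro mult_right_mono mult_left_mono) auto
  finally have second: "\<bar>\<Sum>k\<in>V. \<Sum>j\<in>nb k. ?B k j - ?C k j * ?F\<bar> \<le> 4 * H * stein_error" by simp
  from first second show ?thesis unfolding split by linarith
qed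

end
end

section \<open>Gaussian smoothing of distribution functions\<close>

abbreviation normal_cdf :: "real \<Rightarrow> real" where
  "normal_cdf \<equiv> cdf std_normal_distribution"

interpretation std_normal: real_distribution std_normal_distribution
  by (rule real_dist_normal_dist)

text \<open>
  The crude bound \<open>pi \<ge> 2\<close> leaves enough room in the final constant.
\<close>

lemma std_normal_density_le_half: "std_normal_density x \<le> 1 / 2"
proof -
  have "2 = sqrt 4" by simp
  also have "\<dots> \<le> sqrt (2 * pi)" using pi_ge_two by (intro real_sqrt_le_mono) simp
  finally have "1 / sqrt (2 * pi) \<le> 1 / 2" by (intro divide_left_mono) auto
  moreover have "exp (- x\<^sup>2 / 2) \<le> 1" by simp
  ultimately have "1 / sqrt (2 * pi) * exp (- x\<^sup>2 / 2) \<le> 1 / 2 * 1"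
    by (intro mult_mono) auto
  then show ?thesis by (simp add: std_normal_density_def)
qed

lemma DERIV_std_normal_density:
  "(std_normal_density has_real_derivative (- x * std_normal_density x)) (at x)"
proof -
  have "((\<lambda>x. c * exp (- x\<^sup>2 / 2)) has_real_derivative (- x * (c * exp (- x\<^sup>2 / 2)))) (at x)" for c
    by (auto intro!: derivative_eq_intros)
  then show ?thesis unfolding std_normal_density_def[abs_def] .
qed

lemma DERIV_normal_cdf: "(normal_cdf has_real_derivative std_normal_density x) (at x)"
proof -
  let ?a = "x - 1" and ?b = "x + 1"
  have cont: "continuous_on S std_normal_density" for S
    by (intro continuous_at_imp_continuous_on ballI DERIV_isCont[OF DERIV_std_normal_density])
  have "normal_cdf y = normal_cdf ?a + integral {?a..y} std_normal_density" if "?a < y" for y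
  proof -
    have i: "set_integrable lborel {?a<..y} std_normal_density"
      unfolding set_integrable_def
      using integrable_std_normal_moment[of 0] by (intro integrable_mult_indicator) auto
    have "normal_cdf y - normal_cdf ?a = measure std_normal_distribution {?a<..y}"
      using that by (rule std_normal.cdf_diff_eq)
    also have "\<dots> = (LINT z|std_normal_distribution. indicator {?a<..y} z)"
      by simp
    also have "\<dots> = (LINT z:{?a<..y}|lborel. std_normal_density z)"
      unfolding set_lebesgue_integral_def
      by (subst integral_density) (auto intro!: Bochner_Integration.integral_cong simp: mult.commute)
    also have "\<dots> = integral {?a<..y} std_normal_density"
      using set_borel_integral_eq_integral(2)[OF i] .
    also have "\<dots> = integral {?a..y} std_normal_density"
      by (rule integral_spike_set) (auto intro: negligible_subset[of "{?a}"])
    finally show ?thesis by simp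
  qed
  note cdf_eq = this
  have "((\<lambda>y. normal_cdf ?a + integral {?a..y} std_normal_density)
      has_real_derivative (0 + std_normal_density x)) (at x within {?a..?b})"
    by (intro DERIV_add DERIV_const integral_has_real_derivative cont) auto
  then have "((\<lambda>y. normal_cdf ?a + integral {?a..y} std_normal_density)
      has_real_derivative std_normal_density x) (at x)"
    by (simp add: at_within_Icc_at)
  then show ?thesis
    by (rule has_field_derivative_transform_within_open[where S = "{?a<..}"]) (auto simp: cdf_eq)
qed

lemma normal_cdf_lipschitz: "\<bar>normal_cdf x - normal_cdf y\<bar> \<le> \<bar>x - y\<bar> / 2"
proof -
  have "norm (normal_cdf x - normal_cdf y) \<le> 1 / 2 * norm (x - y)"
  proof (rule field_differentiable_bound[where S = UNIV])
    show "norm (std_normal_density z) \<le> 1 / 2" for z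
      using std_normal_density_le_half[of z] by simp
  qed (auto intro: DERIV_normal_cdf)
  then show ?thesis by simp
qed

lemma measurable_normal_cdf [measurable]: "normal_cdf \<in> borel_measurable borel"
  by (intro borel_measurable_continuous_onI continuous_at_imp_continuous_on)
    (auto intro: DERIV_isCont[OF DERIV_normal_cdf])

text \<open>Minus the derivative of the normal density, hence the density times the first Hermite polynomial.\<close>

definition hermite_density :: "real \<Rightarrow> real" where
  "hermite_density x = x * std_normal_density x"

text \<open>
  The function is bounded by 3/8 and Lipschitz with constant 1/2, so for distances above 1 the first bound
  applies and for distances below 1 the second. Both follow from \<open>exp (z\<^sup>2 / 2) \<ge> 1 + z\<^sup>2 / 2 + (z\<^sup>2 / 2)\<^sup>2 / 2\<close>.
\<close>

lemma hermite_density_hoelder: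
  assumes "0 \<le> p" "p \<le> 1"
  shows "\<bar>hermite_density x - hermite_density y\<bar> \<le> 3 / 4 * \<bar>x - y\<bar> powr p"
proof -
  have density: "\<bar>c\<bar> * std_normal_density z \<le> a / 2"
    if "\<bar>c\<bar> \<le> a * (1 + z\<^sup>2 / 2 + (z\<^sup>2 / 2)\<^sup>2 / 2)" "0 \<le> a" for a c z :: real
  proof -
    have "\<bar>c\<bar> \<le> a * exp (z\<^sup>2 / 2)"
      using that exp_lower_Taylor_quadratic[of "z\<^sup>2 / 2"]
      by (intro order_trans[OF that(1)] mult_left_mono) auto
    then have "\<bar>c\<bar> * exp (- z\<^sup>2 / 2) \<le> a"
      by (simp add: exp_minus field_simps)
    moreover have "1 / sqrt (2 * pi) \<le> 1 / 2"
      using std_normal_density_le_half[of 0] by (simp add: std_normal_density_def)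
    ultimately have "1 / sqrt (2 * pi) * (\<bar>c\<bar> * exp (- z\<^sup>2 / 2)) \<le> 1 / 2 * a"
      by (intro mult_mono) auto
    then show ?thesis by (simp add: std_normal_density_def mult_ac)
  qed
  have bounded: "\<bar>hermite_density z\<bar> \<le> 3 / 8" for z
  proof -
    have "\<bar>z\<bar> \<le> 3 / 4 * (1 + z\<^sup>2 / 2)"
      using zero_le_power2[of "\<bar>z\<bar> - 4 / 3"] by (simp add: power2_eq_square algebra_simps)
    then have "\<bar>z\<bar> \<le> 3 / 4 * (1 + z\<^sup>2 / 2 + (z\<^sup>2 / 2)\<^sup>2 / 2)"
      by (rule order_trans) simp
    from density[OF this] show ?thesis by (simp add: hermite_density_def abs_mult)
  qed
  have "norm (hermite_density x - hermite_density y) \<le> 1 / 2 * norm (x - y)"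
  proof (rule field_differentiable_bound[where S = UNIV])
    fix z :: real
    show "(hermite_density has_field_derivative ((1 - z\<^sup>2) * std_normal_density z)) (at z within UNIV)"
      unfolding hermite_density_def[abs_def]
      by (auto intro!: derivative_eq_intros DERIV_std_normal_density
          simp: power2_eq_square algebra_simps)
    have "\<bar>1 - z\<^sup>2\<bar> \<le> 1 * (1 + z\<^sup>2 / 2 + (z\<^sup>2 / 2)\<^sup>2 / 2)"
    proof -
      have "\<bar>1 - u\<bar> \<le> 1 * (1 + u / 2 + (u / 2)\<^sup>2 / 2)" if "0 \<le> u" for u :: real
        using zero_le_power2[of "u - 2"] zero_le_power2[of u] that
        by (auto simp: abs_if power2_eq_square algebra_simps)
      then show ?thesis by simp
    qed
    from density[OF this]
    show "norm ((1 - z\<^sup>2) * std_normal_density z) \<le> 1 / 2"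
      by (simp add: abs_mult)
  qed auto
  then have lipschitz: "\<bar>hermite_density x - hermite_density y\<bar> \<le> 1 / 2 * \<bar>x - y\<bar>" by simp
  show ?thesis
  proof (cases "\<bar>x - y\<bar> \<le> 1")
    case True
    then have "\<bar>x - y\<bar> powr 1 \<le> \<bar>x - y\<bar> powr p"
      using assms True by (intro powr_mono') auto
    with lipschitz show ?thesis by simp
  next
    case False
    then have "1 \<le> \<bar>x - y\<bar> powr p" using assms by (intro ge_one_powr_ge_zero) auto
    with bounded[of x] bounded[of y] show ?thesis by linarith
  qed
qed

lemma measure_normal_atMost:
  assumes "0 < \<sigma>"
  shows "measure (density lborel (normal_density 0 \<sigma>)) {..t} = normal_cdf (t / \<sigma>)"
proof -
  interpret N: prob_space "density lborel (normal_density 0 \<sigma>)"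
    using assms by (rule prob_space_normal_density)
  have "distributed std_normal_distribution lborel (\<lambda>x. x) std_normal_density"
    by (auto simp: distributed_def distr_id2)
  from std_normal.normal_density_affine[OF this, of \<sigma> 0]
  have "distr std_normal_distribution lborel (\<lambda>x. \<sigma> * x) = density lborel (normal_density 0 \<sigma>)"
    using assms by (simp add: distributed_def)
  then have "measure (density lborel (normal_density 0 \<sigma>)) {..t}
      = measure (distr std_normal_distribution lborel (\<lambda>x. \<sigma> * x)) {..t}" by simp
  also have "\<dots> = measure std_normal_distribution {..t / \<sigma>}"
    using assms by (subst measure_distr) (auto intro!: arg_cong2[where f = measure] simp: field_simps)
  finally show ?thesis by (simp add: cdf_def)
qed

text \<open>
  The sum of independent centred normal variables with variances 1 and \<open>h\<^sup>2\<close> is normal with variance \<open>1 + h\<^sup>2\<close>.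
\<close>

lemma normal_cdf_smoothed:
  assumes "0 < h"
  shows "(LINT x|std_normal_distribution. normal_cdf ((t - x) / h)) = normal_cdf (t / sqrt (1 + h\<^sup>2))"
proof -
  let ?N = "\<lambda>\<sigma>. density lborel (normal_density 0 \<sigma>)"
  interpret h: prob_space "?N h" using assms by (rule prob_space_normal_density)
  have h1: "0 < sqrt (1 + h\<^sup>2)" by (simp add: add_pos_nonneg)
  interpret h1: prob_space "?N (sqrt (1 + h\<^sup>2))" using h1 by (rule prob_space_normal_density)
  have conv: "std_normal_distribution \<star> ?N h = ?N (sqrt (1 + h\<^sup>2))"
    using conv_normal_density_zero_mean[of 1 h] assms
    by (subst convolution_density)
      (auto simp: h.finite_measure_axioms std_normal.finite_measure_axioms ennreal_mult'[symmetric])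
  have "ennreal (normal_cdf (t / sqrt (1 + h\<^sup>2))) = emeasure (?N (sqrt (1 + h\<^sup>2))) {..t}"
    by (simp add: measure_normal_atMost[OF h1, symmetric] h1.emeasure_eq_measure)
  also have "\<dots> = (\<integral>\<^sup>+x. emeasure (?N h) {a. a + x \<in> {..t}} \<partial>std_normal_distribution)"
    unfolding conv[symmetric]
    by (rule convolution_emeasure) (auto simp: h.finite_measure_axioms std_normal.finite_measure_axioms)
  also have "\<dots> = (\<integral>\<^sup>+x. ennreal (normal_cdf ((t - x) / h)) \<partial>std_normal_distribution)"
  proof (rule nn_integral_cong)
    fix x
    have "{a. a + x \<in> {..t}} = {..t - x}" by auto
    then show "emeasure (?N h) {a. a + x \<in> {..t}} = ennreal (normal_cdf ((t - x) / h))"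
      by (simp add: measure_normal_atMost[OF assms, symmetric] h.emeasure_eq_measure)
  qed
  finally have "(\<integral>\<^sup>+x. ennreal (normal_cdf ((t - x) / h)) \<partial>std_normal_distribution)
      = ennreal (normal_cdf (t / sqrt (1 + h\<^sup>2)))" by simp
  then show ?thesis
    by (subst integral_eq_nn_integral) (auto simp: std_normal.cdf_nonneg)
qed

text \<open>
  Both sides are the probability that \<open>x + h * z \<le> t\<close>, where \<open>x\<close> has law \<open>\<mu>\<close> and \<open>z\<close> is an independent standard
  normal variable.
\<close>

lemma smoothed_cdf_swap:
  assumes "real_distribution \<mu>" "0 < h"
  shows "(LINT x|\<mu>. normal_cdf ((t - x) / h)) = (LINT z|std_normal_distribution. cdf \<mu> (t - h * z))"
proof -
  interpret \<mu>: real_distribution \<mu> by fact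
  interpret pair_prob_space std_normal_distribution \<mu> ..
  let ?A = "{p. snd p + h * fst p \<le> t} :: (real \<times> real) set"
  have [measurable]: "?A \<in> sets (borel \<Otimes>\<^sub>M borel)"
    unfolding borel_prod by (intro borel_closed closed_Collect_le continuous_intros)
  have "integrable (std_normal_distribution \<Otimes>\<^sub>M \<mu>) (indicator ?A :: _ \<Rightarrow> real)"
    by (intro integrable_const_bound[where B = 1]) (auto split: split_indicator)
  then have "(LINT x|\<mu>. LINT z|std_normal_distribution. indicator ?A (z, x))
      = (LINT z|std_normal_distribution. LINT x|\<mu>. indicator ?A (z, x) :: real)"
    by (intro Fubini_integral) (simp add: case_prod_eta)
  moreover have "(LINT z|std_normal_distribution. indicator ?A (z, x) :: real)
      = normal_cdf ((t - x) / h)" for x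
  proof -
    have "(\<lambda>z. indicator ?A (z, x) :: real) = indicator {..(t - x) / h}"
      using assms by (auto simp: fun_eq_iff indicator_def field_simps)
    then show ?thesis by (simp add: cdf_def)
  qed
  moreover have "(LINT x|\<mu>. indicator ?A (z, x) :: real) = cdf \<mu> (t - h * z)" for z
  proof -
    have "(\<lambda>x. indicator ?A (z, x) :: real) = indicator {..t - h * z}"
      by (auto simp: fun_eq_iff indicator_def)
    then show ?thesis by (simp add: cdf_def)
  qed
  ultimately show ?thesis by simp
qed

text \<open>
  A function that is at least \<open>q\<close> on \<open>[-2, 2]\<close> loses at most a quarter of \<open>q + K\<close> in the average, because
  by Chebyshev's inequality the normal law gives the complement of \<open>[-2, 2]\<close> mass at most 1/4. The inequality
  \<open>q - (q + K) * z\<^sup>2 / 4 \<le> d z\<close> combines the two bounds on \<open>d\<close> so that only the second moment enters.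
\<close>

lemma lower_bound_from_normal_average:
  fixes d :: "real \<Rightarrow> real" and K q \<eta> :: real
  assumes [measurable]: "d \<in> borel_measurable borel"
    and K: "\<And>z. \<bar>d z\<bar> \<le> K"
    and q: "\<And>z. \<bar>z\<bar> \<le> 2 \<Longrightarrow> q \<le> d z"
    and average: "(LINT z|std_normal_distribution. d z) \<le> \<eta>" and "0 \<le> \<eta>"
  shows "q \<le> (4 * \<eta> + K) / 3"
proof (cases "0 \<le> q + K")
  case True
  have second_moment: "integrable std_normal_distribution (\<lambda>z. z\<^sup>2)"
    "(LINT z|std_normal_distribution. z\<^sup>2) = 1"
    using std_normal_distribution_even_moments[of 1] by auto
  have "q - (q + K) * z\<^sup>2 / 4 \<le> d z" for z
  proof (cases "\<bar>z\<bar> \<le> 2")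
    case True
    then show ?thesis using q[of z] \<open>0 \<le> q + K\<close> by (smt (verit) divide_nonneg_pos mult_nonneg_nonneg zero_le_power2)
  next
    case False
    then have "2\<^sup>2 \<le> \<bar>z\<bar>\<^sup>2" by (intro power_mono) auto
    then have "(q + K) * 4 \<le> (q + K) * z\<^sup>2" using \<open>0 \<le> q + K\<close> by (intro mult_left_mono) auto
    then show ?thesis using K[of z] by simp
  qed
  then have "(LINT z|std_normal_distribution. q - (q + K) * z\<^sup>2 / 4) \<le> (LINT z|std_normal_distribution. d z)"
  proof (intro integral_mono)
    show "integrable std_normal_distribution d"
      using K by (intro std_normal.integrable_const_bound[where B = K]) auto
  qed (use second_moment in auto)
  also have "(LINT z|std_normal_distribution. q - (q + K) * z\<^sup>2 / 4) = q - (q + K) / 4"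
    using second_moment std_normal.prob_space by simp
  also note average
  finally show ?thesis by (simp add: field_simps)
next
  case False
  with K[of 0] \<open>0 \<le> \<eta>\<close> show ?thesis by simp
qed

text \<open>
  If the distribution functions differ by nearly the supremum \<open>K\<close> at \<open>t\<close>, then by monotonicity of one and
  Lipschitz continuity of the other they differ by almost as much on the whole interval \<open>[t, t + 4 * h]\<close> (or
  \<open>[t - 4 * h, t]\<close>, depending on the sign). Averaging over normal noise of scale \<open>h\<close> centred at the midpoint bounds
  \<open>K\<close> by \<open>(4 * \<eta> + K) / 3 + 2 * h\<close>, which is solved for \<open>K\<close>.
\<close>

lemma kolmogorov_dist_le_smoothed:
  assumes "real_distribution \<mu>" "0 < h"
    and \<eta>: "\<And>t. \<bar>(LINT x|\<mu>. normal_cdf ((t - x) / h)) - normal_cdf (t / sqrt (1 + h\<^sup>2))\<bar> \<le> \<eta>"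
  shows "(SUP t. \<bar>cdf \<mu> t - normal_cdf t\<bar>) \<le> 2 * \<eta> + 3 * h"
proof -
  interpret \<mu>: real_distribution \<mu> by fact
  define K where "K = (SUP t. \<bar>cdf \<mu> t - normal_cdf t\<bar>)"
  have "\<bar>cdf \<mu> t - normal_cdf t\<bar> \<le> 1" for t
    using \<mu>.cdf_bounded_prob[of t] std_normal.cdf_bounded_prob[of t]
      \<mu>.cdf_nonneg[of t] std_normal.cdf_nonneg[of t] by linarith
  then have K: "\<bar>cdf \<mu> t - normal_cdf t\<bar> \<le> K" for t
    unfolding K_def by (intro cSUP_upper bdd_aboveI2[where M = 1]) auto
  have [measurable]: "cdf \<mu> \<in> borel_measurable borel"
    by (intro borel_measurable_mono) (auto intro!: monoI \<mu>.cdf_nondecreasing)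
  have \<eta>0: "0 \<le> \<eta>" using \<eta>[of 0] by linarith
  have average: "\<bar>LINT z|std_normal_distribution. cdf \<mu> (t - h * z) - normal_cdf (t - h * z)\<bar> \<le> \<eta>" for t
  proof -
    have i: "integrable std_normal_distribution (\<lambda>z. cdf \<nu> (t - h * z))"
      if "real_distribution \<nu>" and [measurable]: "cdf \<nu> \<in> borel_measurable borel" for \<nu>
    proof -
      interpret \<nu>: real_distribution \<nu> by fact
      show ?thesis
        using \<nu>.cdf_nonneg \<nu>.cdf_bounded_prob
        by (intro std_normal.integrable_const_bound[where B = 1]) auto
    qed
    show ?thesis
      using \<eta>[of t] i[OF assms(1)] i[OF real_dist_normal_dist]
        normal_cdf_smoothed[OF assms(2), of t] smoothed_cdf_swap[OF assms(1,2), of t]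
        smoothed_cdf_swap[OF real_dist_normal_dist assms(2), of t] by simp
  qed
  have shift: "a \<le> b + 2 * h" if "\<bar>a - b\<bar> \<le> s / 2" "s \<le> 4 * h" for a b s :: real
    using that by linarith
  have "\<bar>cdf \<mu> t - normal_cdf t\<bar> \<le> (4 * \<eta> + K) / 3 + 2 * h" for t
  proof -
    have "cdf \<mu> t - normal_cdf t - 2 * h \<le> (4 * \<eta> + K) / 3"
    proof (rule lower_bound_from_normal_average)
      let ?d = "\<lambda>z. cdf \<mu> (t + 2 * h - h * z) - normal_cdf (t + 2 * h - h * z)"
      show "\<bar>?d z\<bar> \<le> K" for z by (rule K)
      show "(LINT z|std_normal_distribution. ?d z) \<le> \<eta>" using average[of "t + 2 * h"] by linarith
      show "cdf \<mu> t - normal_cdf t - 2 * h \<le> ?d z" if "\<bar>z\<bar> \<le> 2" for z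
      proof -
        have z: "h * z \<le> h * 2" "- (h * 2) \<le> h * z"
          using that assms(2) mult_left_mono[of z 2 h] mult_left_mono[of "-2" z h] by auto
        then have "cdf \<mu> t \<le> cdf \<mu> (t + 2 * h - h * z)" by (intro \<mu>.cdf_nondecreasing) simp
        moreover have "normal_cdf (t + 2 * h - h * z) \<le> normal_cdf t + 2 * h"
          using z by (intro shift[OF normal_cdf_lipschitz]) (simp add: abs_le_iff)
        ultimately show ?thesis by simp
      qed
    qed (use \<eta>0 in measurable)
    moreover have "normal_cdf t - cdf \<mu> t - 2 * h \<le> (4 * \<eta> + K) / 3"
    proof (rule lower_bound_from_normal_average)
      let ?d = "\<lambda>z. normal_cdf (t - 2 * h - h * z) - cdf \<mu> (t - 2 * h - h * z)"
      show "\<bar>?d z\<bar> \<le> K" for z using K by (simp add: abs_minus_commute)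
      show "(LINT z|std_normal_distribution. ?d z) \<le> \<eta>"
        using average[of "t - 2 * h"] integral_minus[of std_normal_distribution ?d] by (simp add: abs_le_iff)
      show "normal_cdf t - cdf \<mu> t - 2 * h \<le> ?d z" if "\<bar>z\<bar> \<le> 2" for z
      proof -
        have z: "h * z \<le> h * 2" "- (h * 2) \<le> h * z"
          using that assms(2) mult_left_mono[of z 2 h] mult_left_mono[of "-2" z h] by auto
        then have "cdf \<mu> (t - 2 * h - h * z) \<le> cdf \<mu> t" by (intro \<mu>.cdf_nondecreasing) simp
        moreover have "normal_cdf t \<le> normal_cdf (t - 2 * h - h * z) + 2 * h"
          using z by (intro shift[OF normal_cdf_lipschitz]) (simp add: abs_le_iff)
        ultimately show ?thesis by simp
      qed
    qed (use \<eta>0 in measurable)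
    ultimately show ?thesis by linarith
  qed
  then have "K \<le> (4 * \<eta> + K) / 3 + 2 * h" unfolding K_def by (intro cSUP_least) auto
  then show ?thesis unfolding K_def[symmetric] by (simp add: field_simps)
qed

section \<open>Interpolation between the two smoothed laws\<close>

text \<open>
  Differentiation under the integral sign: dominated convergence applied to the difference quotients, which
  the mean value inequality bounds by \<open>G\<close>.
\<close>

lemma has_real_derivative_integral:
  fixes g g' :: "real \<Rightarrow> 'w \<Rightarrow> real"
  assumes s: "s \<in> {a<..<b}"
    and integrable: "\<And>r. r \<in> {a<..<b} \<Longrightarrow> integrable M (g r)"
    and deriv: "\<And>r \<omega>. r \<in> {a<..<b} \<Longrightarrow> ((\<lambda>r. g r \<omega>) has_real_derivative g' r \<omega>) (at r)"
    and bound: "\<And>r \<omega>. r \<in> {a<..<b} \<Longrightarrow> \<bar>g' r \<omega>\<bar> \<le> G \<omega>"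
    and "integrable M G" and [measurable]: "g' s \<in> borel_measurable M"
  shows "((\<lambda>r. LINT \<omega>|M. g r \<omega>) has_real_derivative (LINT \<omega>|M. g' s \<omega>)) (at s)"
proof -
  have "((\<lambda>r. ((LINT \<omega>|M. g r \<omega>) - (LINT \<omega>|M. g s \<omega>)) / (r - s)) \<longlongrightarrow> (LINT \<omega>|M. g' s \<omega>))
      (at s within {a<..<b})"
    unfolding tendsto_at_iff_sequentially
  proof (intro allI impI)
    fix R :: "nat \<Rightarrow> real"
    assume "\<forall>i. R i \<in> {a<..<b} - {s}" and R_lim: "R \<longlonglongrightarrow> s"
    then have R: "R i \<in> {a<..<b}" "R i - s \<noteq> 0" for i by auto
    note [measurable] = integrable[OF R(1), THEN borel_measurable_integrable]
      integrable[OF s, THEN borel_measurable_integrable]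
    have quotient: "(LINT \<omega>|M. (g (R i) \<omega> - g s \<omega>) / (R i - s))
        = ((LINT \<omega>|M. g (R i) \<omega>) - (LINT \<omega>|M. g s \<omega>)) / (R i - s)" for i
      using integrable[OF R(1), of i] integrable[OF s] by simp
    have "(\<lambda>i. LINT \<omega>|M. (g (R i) \<omega> - g s \<omega>) / (R i - s)) \<longlonglongrightarrow> (LINT \<omega>|M. g' s \<omega>)"
    proof (rule integral_dominated_convergence)
      show "(\<lambda>\<omega>. (g (R i) \<omega> - g s \<omega>) / (R i - s)) \<in> borel_measurable M" for i
        by measurable
      show "AE \<omega> in M. (\<lambda>i. (g (R i) \<omega> - g s \<omega>) / (R i - s)) \<longlonglongrightarrow> g' s \<omega>"
      proof (rule AE_I2)
        fix \<omega>
        have "((\<lambda>r. (g r \<omega> - g s \<omega>) / (r - s)) \<longlongrightarrow> g' s \<omega>) (at s)"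
          using deriv[OF s, of \<omega>] by (simp add: has_field_derivative_iff)
        moreover have "filterlim R (at s) sequentially"
          using R(2) R_lim by (auto simp: filterlim_at)
        ultimately show "(\<lambda>i. (g (R i) \<omega> - g s \<omega>) / (R i - s)) \<longlonglongrightarrow> g' s \<omega>"
          by (rule filterlim_compose)
      qed
      show "AE \<omega> in M. norm ((g (R i) \<omega> - g s \<omega>) / (R i - s)) \<le> G \<omega>" for i
      proof (rule AE_I2)
        fix \<omega>
        have "norm (g (R i) \<omega> - g s \<omega>) \<le> G \<omega> * norm (R i - s)"
        proof (rule field_differentiable_bound[where S = "{a<..<b}"])
          show "((\<lambda>r. g r \<omega>) has_field_derivative g' r \<omega>) (at r within {a<..<b})"
            if "r \<in> {a<..<b}" for r
            using deriv[OF that] by (rule DERIV_subset) auto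
          show "norm (g' r \<omega>) \<le> G \<omega>" if "r \<in> {a<..<b}" for r
            using bound[OF that, of \<omega>] by simp
        qed (use R(1) s in simp_all)
        then show "norm ((g (R i) \<omega> - g s \<omega>) / (R i - s)) \<le> G \<omega>"
          unfolding norm_divide using R(2)[of i] by (subst pos_divide_le_eq) (rule zero_less_norm_iff[THEN iffD2])
      qed
      show "integrable M G" "g' s \<in> borel_measurable M" by fact+
    qed
    then show "((\<lambda>r. ((LINT \<omega>|M. g r \<omega>) - (LINT \<omega>|M. g s \<omega>)) / (r - s)) \<circ> R)
        \<longlonglongrightarrow> (LINT \<omega>|M. g' s \<omega>)"
      by (simp only: comp_def quotient)
  qed
  then show ?thesis
    unfolding has_field_derivative_iff at_within_open[OF s open_greaterThanLessThan] .
qed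

text \<open>
  With \<open>f x = std_normal_density ((t - r * x) / \<sigma> r) / \<sigma> r\<close>, the first derivative is \<open>f' w - w * f w\<close>, the
  Stein operator applied to \<open>f\<close>; this is the reason for the choice of \<open>\<sigma>\<close>. The second part provides the
  comparison function: its derivative is the bound that Stein's method gives for the first one.
\<close>

lemma DERIV_interpolation:
  assumes "0 < \<sigma> r" and \<sigma>: "\<And>r. \<sigma> r = sqrt (1 + h\<^sup>2 - r\<^sup>2)"
  shows "((\<lambda>r. normal_cdf ((t - r * w) / \<sigma> r)) has_real_derivative
      r / (\<sigma> r)\<^sup>2 * hermite_density ((t - r * w) / \<sigma> r)
      - w * (std_normal_density ((t - r * w) / \<sigma> r) / \<sigma> r)) (at r)"
    and "((\<lambda>r. c / \<sigma> r) has_real_derivative c * r / (\<sigma> r) ^ 3) (at r)"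
proof -
  have "0 < 1 + h\<^sup>2 - r\<^sup>2" using assms by simp
  then have d\<sigma>: "(\<sigma> has_real_derivative (- r / \<sigma> r)) (at r)"
    unfolding \<sigma>[abs_def] by (auto intro!: derivative_eq_intros simp: field_simps)
  show "((\<lambda>r. c / \<sigma> r) has_real_derivative c * r / (\<sigma> r) ^ 3) (at r)"
    using assms(1) by (auto intro!: derivative_eq_intros d\<sigma> simp: field_simps power3_eq_cube)
  let ?q = "\<lambda>r. (t - r * w) / \<sigma> r"
  have "(?q has_real_derivative (?q r * r / (\<sigma> r)\<^sup>2 - w / \<sigma> r)) (at r)"
    using assms(1) by (auto intro!: derivative_eq_intros d\<sigma> simp: field_simps power2_eq_square)
  from DERIV_chain2[OF DERIV_normal_cdf this]
  show "((\<lambda>r. normal_cdf (?q r)) has_real_derivative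
      r / (\<sigma> r)\<^sup>2 * hermite_density (?q r) - w * (std_normal_density (?q r) / \<sigma> r)) (at r)"
    by (rule DERIV_cong) (simp add: hermite_density_def field_simps)
qed

lemma DERIV_stein_test_function:
  assumes "0 < \<sigma>"
  shows "((\<lambda>x. std_normal_density ((t - s * x) / \<sigma>) / \<sigma>) has_real_derivative
    s / \<sigma>\<^sup>2 * hermite_density ((t - s * x) / \<sigma>)) (at x)"
proof -
  have "((\<lambda>x. (t - s * x) / \<sigma>) has_real_derivative (- s / \<sigma>)) (at x)"
    using assms by (auto intro!: derivative_eq_intros)
  from DERIV_cdivide[OF DERIV_chain2[OF DERIV_std_normal_density this], of \<sigma>] show ?thesis
    by (rule DERIV_cong) (simp add: hermite_density_def power2_eq_square)
qed

lemma hermite_density_le: "\<bar>hermite_density x\<bar> \<le> 1"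
  using hermite_density_hoelder[of 0 x 0] by (cases "x = 0") (auto simp: hermite_density_def)

lemma measurable_hermite_density [measurable]: "hermite_density \<in> borel_measurable borel"
  unfolding hermite_density_def[abs_def] by measurable

text \<open>
  Scaling gives the constant \<open>3 / 4 * s powr (1 + p) * \<sigma> powr - (2 + p)\<close>. As \<open>\<sigma>\<close> hardly exceeds 1, the power of
  \<open>\<sigma>\<close> can be lowered to \<open>-3\<close> at the price of a factor 16/15, which makes the bound integrable in closed form along the
  interpolation and independent of \<open>p\<close>.
\<close>

lemma stein_test_function_hoelder:
  assumes "0 \<le> p" "p \<le> 1" "0 < \<sigma>" "\<sigma> \<le> 16 / 15" "0 \<le> s" "s \<le> 1"
  shows "\<bar>s / \<sigma>\<^sup>2 * hermite_density ((t - s * x) / \<sigma>) - s / \<sigma>\<^sup>2 * hermite_density ((t - s * y) / \<sigma>)\<bar>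
    \<le> 4 / 5 * s / \<sigma> ^ 3 * \<bar>x - y\<bar> powr p"
proof -
  have "\<sigma> powr (1 - p) \<le> 16 / 15"
  proof (cases "\<sigma> \<le> 1")
    case True
    then have "\<sigma> powr (1 - p) \<le> 1" using assms by (intro powr_le1) auto
    then show ?thesis by simp
  next
    case False
    then have "\<sigma> powr (1 - p) \<le> \<sigma> powr 1" using assms by (intro powr_mono) auto
    then show ?thesis using assms by simp
  qed
  then have "\<sigma> powr (- p) \<le> 16 / 15 / \<sigma>"
    using assms by (simp add: powr_diff powr_minus field_simps)
  then have "\<bar>x - y\<bar> powr p * \<sigma> powr (- p) \<le> \<bar>x - y\<bar> powr p * (16 / 15 / \<sigma>)"
    by (intro mult_left_mono) auto
  moreover have "\<bar>(t - s * x) / \<sigma> - (t - s * y) / \<sigma>\<bar> powr p \<le> (\<bar>x - y\<bar> / \<sigma>) powr p"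
  proof (rule powr_mono2)
    have "(t - s * x) / \<sigma> - (t - s * y) / \<sigma> = s * (y - x) / \<sigma>"
      by (simp add: algebra_simps diff_divide_distrib)
    then show "\<bar>(t - s * x) / \<sigma> - (t - s * y) / \<sigma>\<bar> \<le> \<bar>x - y\<bar> / \<sigma>"
      using assms by (simp add: abs_mult abs_minus_commute divide_right_mono mult_left_le_one_le)
  qed (use assms in auto)
  moreover have "(\<bar>x - y\<bar> / \<sigma>) powr p = \<bar>x - y\<bar> powr p * \<sigma> powr (- p)"
    using assms by (simp add: powr_divide powr_minus field_simps)
  ultimately have "\<bar>(t - s * x) / \<sigma> - (t - s * y) / \<sigma>\<bar> powr p \<le> \<bar>x - y\<bar> powr p * (16 / 15 / \<sigma>)"
    by linarith
  with hermite_density_hoelder[OF assms(1,2), of "(t - s * x) / \<sigma>" "(t - s * y) / \<sigma>"]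
  have "\<bar>hermite_density ((t - s * x) / \<sigma>) - hermite_density ((t - s * y) / \<sigma>)\<bar>
      \<le> 3 / 4 * (\<bar>x - y\<bar> powr p * (16 / 15 / \<sigma>))" by linarith
  then have "s / \<sigma>\<^sup>2 * \<bar>hermite_density ((t - s * x) / \<sigma>) - hermite_density ((t - s * y) / \<sigma>)\<bar>
      \<le> s / \<sigma>\<^sup>2 * (3 / 4 * (\<bar>x - y\<bar> powr p * (16 / 15 / \<sigma>)))"
    using assms by (intro mult_left_mono) auto
  also have "\<dots> = 4 / 5 * s / \<sigma> ^ 3 * \<bar>x - y\<bar> powr p"
    by (simp add: power2_eq_square power3_eq_cube)
  finally have "\<bar>s / \<sigma>\<^sup>2\<bar> * \<bar>hermite_density ((t - s * x) / \<sigma>) - hermite_density ((t - s * y) / \<sigma>)\<bar>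
      \<le> 4 / 5 * s / \<sigma> ^ 3 * \<bar>x - y\<bar> powr p" using assms by simp
  then show ?thesis by (simp only: abs_mult right_diff_distrib[symmetric])
qed

context centred_local_dependence
begin

lemma measurable_W [measurable]: "W \<in> borel_measurable M"
  by (rule measurable_psum[OF order_refl])

lemma stein_gaussian_test_function:
  assumes "0 < \<sigma>" "\<sigma> \<le> 16 / 15" "0 \<le> s" "s \<le> 1"
  shows "\<bar>expectation (\<lambda>\<omega>. W \<omega> * (std_normal_density ((t - s * W \<omega>) / \<sigma>) / \<sigma>)
      - s / \<sigma>\<^sup>2 * hermite_density ((t - s * W \<omega>) / \<sigma>))\<bar> \<le> 4 * stein_error * s / \<sigma> ^ 3"
proof -
  have "\<bar>expectation (\<lambda>\<omega>. W \<omega> * (std_normal_density ((t - s * W \<omega>) / \<sigma>) / \<sigma>)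
      - s / \<sigma>\<^sup>2 * hermite_density ((t - s * W \<omega>) / \<sigma>))\<bar> \<le> 5 * (4 / 5 * s / \<sigma> ^ 3) * stein_error"
  proof (rule stein_bound[where b = "1 / \<sigma> + 1 / \<sigma>\<^sup>2"])
    fix x :: real
    have "std_normal_density ((t - s * x) / \<sigma>) / \<sigma> \<le> 1 / \<sigma>"
      using std_normal_density_le_half[of "(t - s * x) / \<sigma>"] assms by (intro divide_right_mono) auto
    moreover have "s / \<sigma>\<^sup>2 * \<bar>hermite_density ((t - s * x) / \<sigma>)\<bar> \<le> 1 / \<sigma>\<^sup>2 * 1"
      using hermite_density_le assms by (intro mult_mono divide_right_mono) auto
    ultimately show "\<bar>std_normal_density ((t - s * x) / \<sigma>) / \<sigma>\<bar> \<le> 1 / \<sigma> + 1 / \<sigma>\<^sup>2"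
      "\<bar>s / \<sigma>\<^sup>2 * hermite_density ((t - s * x) / \<sigma>)\<bar> \<le> 1 / \<sigma> + 1 / \<sigma>\<^sup>2"
      using assms by (auto simp: abs_mult add_increasing add_increasing2)
  next
    fix x y :: real
    show "\<bar>s / \<sigma>\<^sup>2 * hermite_density ((t - s * x) / \<sigma>) - s / \<sigma>\<^sup>2 * hermite_density ((t - s * y) / \<sigma>)\<bar>
      \<le> 4 / 5 * s / \<sigma> ^ 3 * \<bar>x - y\<bar> powr (\<delta> - 2)"
      using assms \<delta> by (intro stein_test_function_hoelder) auto
  next
    show "((\<lambda>x. std_normal_density ((t - s * x) / \<sigma>) / \<sigma>) has_real_derivative
        s / \<sigma>\<^sup>2 * hermite_density ((t - s * x) / \<sigma>)) (at x)" for x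
      by (rule DERIV_stein_test_function[OF assms(1)])
    show "(\<lambda>x. s / \<sigma>\<^sup>2 * hermite_density ((t - s * x) / \<sigma>)) \<in> borel_measurable borel"
      by measurable
    show "0 \<le> 4 / 5 * s / \<sigma> ^ 3" using assms by simp
  qed
  then show ?thesis by (simp add: mult_ac)
qed

text \<open>
  The derivative of \<open>u s = expectation (\<lambda>\<omega>. normal_cdf ((t - s * W \<omega>) / \<sigma> s))\<close> is at most that of
  \<open>4 * stein_error / \<sigma> s\<close> in absolute value, so the increment of \<open>u\<close> over \<open>[0, 1]\<close> is at most the increment of
  the latter function, whose value at 1 is \<open>4 * stein_error / h\<close>.
\<close>

lemma interpolation_bound:
  assumes "0 < h" "h\<^sup>2 \<le> 1 / 10"
  shows "\<bar>expectation (\<lambda>\<omega>. normal_cdf ((t - W \<omega>) / h)) - normal_cdf (t / sqrt (1 + h\<^sup>2))\<bar>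
    \<le> 4 * stein_error / h"
proof -
  define \<sigma> where "\<sigma> r = sqrt (1 + h\<^sup>2 - r\<^sup>2)" for r
  define u where "u r = expectation (\<lambda>\<omega>. normal_cdf ((t - r * W \<omega>) / \<sigma> r))" for r
  define g' where "g' r \<omega> = r / (\<sigma> r)\<^sup>2 * hermite_density ((t - r * W \<omega>) / \<sigma> r)
      - W \<omega> * (std_normal_density ((t - r * W \<omega>) / \<sigma> r) / \<sigma> r)" for r \<omega>
  \<comment> \<open>on this open interval around \<open>[0, 1]\<close> the scale \<open>\<sigma>\<close> stays above \<open>h / 2\<close>\<close>
  define b where "b = sqrt (1 + 3 / 4 * h\<^sup>2)"
  have b: "1 < b" using assms by (simp add: b_def)
  have \<sigma>_ge: "h / 2 \<le> \<sigma> r" and r_le: "\<bar>r\<bar> \<le> 2" if "r \<in> {-b<..<b}" for r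
  proof -
    have "\<bar>r\<bar> \<le> b" using that by auto
    then have "\<bar>r\<bar>\<^sup>2 \<le> b\<^sup>2" by (rule power_mono) simp
    then have r2: "r\<^sup>2 \<le> 1 + 3 / 4 * h\<^sup>2" by (simp add: b_def)
    then have "(h / 2)\<^sup>2 \<le> 1 + h\<^sup>2 - r\<^sup>2" by (simp add: power_divide)
    then show "h / 2 \<le> \<sigma> r" unfolding \<sigma>_def by (rule real_le_rsqrt)
    have "\<bar>r\<bar>\<^sup>2 \<le> 2\<^sup>2" using r2 assms(2) by simp
    then show "\<bar>r\<bar> \<le> 2" by (rule power2_le_imp_le) simp
  qed
  have du: "(u has_real_derivative expectation (g' s)) (at s)" if s: "s \<in> {-b<..<b}" for s
    unfolding u_def
  proof (rule has_real_derivative_integral[OF s])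
    fix r assume r: "r \<in> {-b<..<b}"
    have \<sigma>: "0 < \<sigma> r" using \<sigma>_ge[OF r] assms by linarith
    show "integrable M (\<lambda>\<omega>. normal_cdf ((t - r * W \<omega>) / \<sigma> r))"
      using std_normal.cdf_nonneg std_normal.cdf_bounded_prob
      by (intro integrable_const_bound[where B = 1]) auto
    show "((\<lambda>r. normal_cdf ((t - r * W \<omega>) / \<sigma> r)) has_real_derivative g' r \<omega>) (at r)" for \<omega>
      unfolding g'_def by (rule DERIV_interpolation(1)[OF \<sigma> \<sigma>_def])
    show "\<bar>g' r \<omega>\<bar> \<le> 2 / (h / 2)\<^sup>2 + \<bar>W \<omega>\<bar> * (1 / (h / 2))" for \<omega>
    proof -
      let ?q = "(t - r * W \<omega>) / \<sigma> r"
      have "\<bar>r\<bar> / (\<sigma> r)\<^sup>2 * \<bar>hermite_density ?q\<bar> \<le> 2 / (h / 2)\<^sup>2 * 1"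
        using r_le[OF r] \<sigma>_ge[OF r] assms hermite_density_le
        by (intro mult_mono frac_le power_mono) auto
      moreover have "\<bar>W \<omega>\<bar> * (std_normal_density ?q / \<sigma> r) \<le> \<bar>W \<omega>\<bar> * (1 / (h / 2))"
        using std_normal_density_le_half[of ?q] \<sigma>_ge[OF r] assms
        by (intro mult_left_mono frac_le) auto
      moreover have "\<bar>g' r \<omega>\<bar> \<le> \<bar>r\<bar> / (\<sigma> r)\<^sup>2 * \<bar>hermite_density ?q\<bar> + \<bar>W \<omega>\<bar> * (std_normal_density ?q / \<sigma> r)"
        unfolding g'_def using \<sigma>
        by (intro order_trans[OF abs_triangle_ineq4]) (simp add: abs_mult)
      ultimately show ?thesis by linarith
    qed
  next
    show "integrable M (\<lambda>\<omega>. 2 / (h / 2)\<^sup>2 + \<bar>W \<omega>\<bar> * (1 / (h / 2)))"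
      using integrable_psum[OF order_refl] by auto
    show "g' s \<in> borel_measurable M" unfolding g'_def by measurable
  qed
  have derivatives: "(u has_real_derivative expectation (g' s)) (at s)"
    "((\<lambda>r. 4 * stein_error / \<sigma> r) has_real_derivative 4 * stein_error * s / (\<sigma> s) ^ 3) (at s)"
    "\<bar>expectation (g' s)\<bar> \<le> 4 * stein_error * s / (\<sigma> s) ^ 3" if s: "0 \<le> s" "s \<le> 1" for s
  proof -
    have sb: "s \<in> {-b<..<b}" using s b by auto
    then have \<sigma>: "0 < \<sigma> s" using \<sigma>_ge[OF sb] assms by linarith
    have "1 + h\<^sup>2 - s\<^sup>2 \<le> (16 / 15)\<^sup>2"
    proof -
      have "h\<^sup>2 - s\<^sup>2 \<le> 1 / 10" using zero_le_power2[of s] assms(2) by linarith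
      then show ?thesis by (simp add: power_divide)
    qed
    then have \<sigma>_le: "\<sigma> s \<le> 16 / 15" unfolding \<sigma>_def by (intro real_le_lsqrt) auto
    show "(u has_real_derivative expectation (g' s)) (at s)" by (rule du[OF sb])
    show "((\<lambda>r. 4 * stein_error / \<sigma> r) has_real_derivative 4 * stein_error * s / (\<sigma> s) ^ 3) (at s)"
      by (rule DERIV_interpolation(2)[OF \<sigma> \<sigma>_def])
    have "expectation (g' s) = - expectation (\<lambda>\<omega>. W \<omega> * (std_normal_density ((t - s * W \<omega>) / \<sigma> s) / \<sigma> s)
      - s / (\<sigma> s)\<^sup>2 * hermite_density ((t - s * W \<omega>) / \<sigma> s))"
      unfolding g'_def by (subst Bochner_Integration.integral_minus[symmetric]) simp
    then show "\<bar>expectation (g' s)\<bar> \<le> 4 * stein_error * s / (\<sigma> s) ^ 3"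
      using stein_gaussian_test_function[OF \<sigma> \<sigma>_le s, of t] by simp
  qed
  have "4 * stein_error / \<sigma> 0 + u 0 \<le> 4 * stein_error / \<sigma> 1 + u 1"
  proof (rule DERIV_nonneg_imp_nondecreasing[of 0 1 "\<lambda>r. 4 * stein_error / \<sigma> r + u r"])
    fix s :: real assume s: "0 \<le> s" "s \<le> 1"
    have "0 \<le> 4 * stein_error * s / (\<sigma> s) ^ 3 + expectation (g' s)"
      using derivatives(3)[OF s] by linarith
    with DERIV_add[OF derivatives(2,1)[OF s]]
    show "\<exists>y. ((\<lambda>r. 4 * stein_error / \<sigma> r + u r) has_real_derivative y) (at s) \<and> 0 \<le> y"
      by blast
  qed simp
  moreover have "4 * stein_error / \<sigma> 0 - u 0 \<le> 4 * stein_error / \<sigma> 1 - u 1"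
  proof (rule DERIV_nonneg_imp_nondecreasing[of 0 1 "\<lambda>r. 4 * stein_error / \<sigma> r - u r"])
    fix s :: real assume s: "0 \<le> s" "s \<le> 1"
    have "0 \<le> 4 * stein_error * s / (\<sigma> s) ^ 3 - expectation (g' s)"
      using derivatives(3)[OF s] by linarith
    with DERIV_diff[OF derivatives(2,1)[OF s]]
    show "\<exists>y. ((\<lambda>r. 4 * stein_error / \<sigma> r - u r) has_real_derivative y) (at s) \<and> 0 \<le> y"
      by blast
  qed simp
  moreover have "0 \<le> 4 * stein_error / \<sigma> 0" using stein_error_nonneg by (simp add: \<sigma>_def)
  ultimately have "\<bar>u 1 - u 0\<bar> \<le> 4 * stein_error / \<sigma> 1" by linarith
  moreover have "\<sigma> 1 = h" using assms by (simp add: \<sigma>_def)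
  moreover have "u 0 = normal_cdf (t / sqrt (1 + h\<^sup>2))" by (simp add: u_def \<sigma>_def prob_space)
  ultimately show ?thesis by (simp add: u_def)
qed

lemma kolmogorov_dist_le_error:
  assumes "0 < h" "h\<^sup>2 \<le> 1 / 10"
  shows "kolmogorov_dist_std_normal M W \<le> 8 * stein_error / h + 3 * h"
proof -
  have "cdf (distr M borel W) t = prob {\<omega> \<in> space M. W \<omega> \<le> t}" for t
  proof -
    have "cdf (distr M borel W) t = prob (W -` {..t} \<inter> space M)"
      unfolding cdf_def by (rule measure_distr) auto
    also have "W -` {..t} \<inter> space M = {\<omega> \<in> space M. W \<omega> \<le> t}" by auto
    finally show ?thesis .
  qed
  then have "kolmogorov_dist_std_normal M W = (SUP t. \<bar>cdf (distr M borel W) t - normal_cdf t\<bar>)"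
    by (simp add: kolmogorov_dist_std_normal_def)
  also have "\<dots> \<le> 2 * (4 * stein_error / h) + 3 * h"
    using interpolation_bound[OF assms] assms(1)
    by (intro kolmogorov_dist_le_smoothed) (auto simp: integral_distr)
  finally show ?thesis by simp
qed

text \<open>
  Otherwise all \<open>X k\<close> would vanish almost surely, against the normalisation of the variance.
\<close>

lemma stein_error_pos: "0 < stein_error"
proof (rule ccontr)
  assume "\<not> 0 < stein_error"
  then have "(\<Sum>k\<in>V. abs_moment k) \<le> 0"
    using mult_pos_pos[of "\<Delta> powr (\<delta> - 1)" "\<Sum>k\<in>V. abs_moment k"]
      powr_gt_zero[THEN iffD2, of \<Delta> "\<delta> - 1"]
    unfolding stein_error_def by linarith
  then have "(\<Sum>k\<in>V. abs_moment k) = 0"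
    using sum_nonneg[of V abs_moment, OF abs_moment_nonneg] by linarith
  then have zero: "abs_moment k = 0" if "k \<in> V" for k
    using that finite_V abs_moment_nonneg by (simp add: sum_nonneg_eq_0_iff)
  have "AE \<omega> in M. \<forall>k\<in>V. X k \<omega> = 0"
  proof (rule AE_finite_allI[OF finite_V])
    fix k assume k: "k \<in> V"
    have "AE \<omega> in M. \<bar>X k \<omega>\<bar> powr \<delta> = 0"
      using integral_nonneg_eq_0_iff_AE[OF moment[OF k]] zero[OF k] by (simp add: abs_moment_def)
    then show "AE \<omega> in M. X k \<omega> = 0" by simp
  qed
  then have "AE \<omega> in M. (W \<omega>)\<^sup>2 = 0"
    by (rule AE_mp) (simp add: psum_def)
  then have "expectation (\<lambda>\<omega>. (W \<omega>)\<^sup>2) = 0"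
    by (rule integral_eq_zero_AE)
  with unit_variance show False by (simp add: psum_def)
qed

end

section \<open>Optimising the smoothing scale\<close>

text \<open>
  Centring at the mean at most doubles the norm in \<open>L\<^sup>\<delta>\<close>: convexity splits the difference, and
  Jensen's inequality bounds the mean by the moment.
\<close>

lemma (in prob_space) centred_abs_moment_le:
  fixes Z :: "'a \<Rightarrow> real" and \<delta> :: real
  assumes [measurable]: "Z \<in> borel_measurable M" and "integrable M Z"
    and moment: "integrable M (\<lambda>\<omega>. \<bar>Z \<omega>\<bar> powr \<delta>)" and "1 < \<delta>"
  shows "integrable M (\<lambda>\<omega>. \<bar>Z \<omega> - expectation Z\<bar> powr \<delta>)"
    and "expectation (\<lambda>\<omega>. \<bar>Z \<omega> - expectation Z\<bar> powr \<delta>)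
      \<le> 2 powr \<delta> * expectation (\<lambda>\<omega>. \<bar>Z \<omega>\<bar> powr \<delta>)"
proof -
  define m where "m = expectation Z"
  have "\<bar>m\<bar> powr \<delta> = \<bar>m\<bar> * \<bar>m\<bar> powr (\<delta> - 1)"
    by (cases "m = 0") (auto simp: powr_diff)
  also have "\<dots> \<le> expectation (\<lambda>\<omega>. \<bar>Z \<omega>\<bar>) * \<bar>m\<bar> powr (\<delta> - 1)"
    unfolding m_def by (intro mult_right_mono integral_abs_bound) auto
  also have "\<dots> = expectation (\<lambda>\<omega>. \<bar>Z \<omega>\<bar> * \<bar>m\<bar> powr (\<delta> - 1))"
    by simp
  also have "\<dots> \<le> expectation (\<lambda>\<omega>. (\<bar>Z \<omega>\<bar> powr \<delta> + (\<delta> - 1) * \<bar>m\<bar> powr \<delta>) / \<delta>)"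
  proof (intro integral_mono)
    show "\<bar>Z \<omega>\<bar> * \<bar>m\<bar> powr (\<delta> - 1) \<le> (\<bar>Z \<omega>\<bar> powr \<delta> + (\<delta> - 1) * \<bar>m\<bar> powr \<delta>) / \<delta>" for \<omega>
      using Young_powr[of "\<bar>Z \<omega>\<bar>" "\<bar>m\<bar>" 1 "\<delta> - 1"] assms(4) by simp
  qed (use assms in auto)
  also have "\<dots> = (expectation (\<lambda>\<omega>. \<bar>Z \<omega>\<bar> powr \<delta>) + (\<delta> - 1) * \<bar>m\<bar> powr \<delta>) / \<delta>"
    using moment by (simp add: prob_space)
  finally have "\<bar>m\<bar> powr \<delta> * \<delta> \<le> expectation (\<lambda>\<omega>. \<bar>Z \<omega>\<bar> powr \<delta>) + (\<delta> - 1) * \<bar>m\<bar> powr \<delta>"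
    using assms(4) by (simp add: field_simps)
  then have jensen: "\<bar>m\<bar> powr \<delta> \<le> expectation (\<lambda>\<omega>. \<bar>Z \<omega>\<bar> powr \<delta>)"
    by (simp add: algebra_simps)
  have pointwise: "\<bar>z - m\<bar> powr \<delta> \<le> 2 powr \<delta> * ((\<bar>z\<bar> powr \<delta> + \<bar>m\<bar> powr \<delta>) / 2)" for z
  proof -
    have "(\<bar>z - m\<bar> / 2) powr \<delta> \<le> (\<bar>z\<bar> powr \<delta> + \<bar>m\<bar> powr \<delta>) / 2"
      using power_mean_powr[of "UNIV :: bool set" 2 \<delta> "\<lambda>b. if b then z else - m"] assms(4)
      by (simp add: UNIV_bool algebra_simps)
    then have "2 powr \<delta> * (\<bar>z - m\<bar> / 2) powr \<delta> \<le> 2 powr \<delta> * ((\<bar>z\<bar> powr \<delta> + \<bar>m\<bar> powr \<delta>) / 2)"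
      by (intro mult_left_mono) auto
    then show ?thesis by (simp flip: powr_mult)
  qed
  have int: "integrable M (\<lambda>\<omega>. 2 powr \<delta> * ((\<bar>Z \<omega>\<bar> powr \<delta> + \<bar>m\<bar> powr \<delta>) / 2))"
    using moment by auto
  show "integrable M (\<lambda>\<omega>. \<bar>Z \<omega> - expectation Z\<bar> powr \<delta>)"
  proof (rule Bochner_Integration.integrable_bound[OF int])
    show "AE \<omega> in M. norm (\<bar>Z \<omega> - expectation Z\<bar> powr \<delta>)
        \<le> norm (2 powr \<delta> * ((\<bar>Z \<omega>\<bar> powr \<delta> + \<bar>m\<bar> powr \<delta>) / 2))"
      using order_trans[OF pointwise abs_ge_self] by (auto simp: m_def)
  qed measurable
  then have "expectation (\<lambda>\<omega>. \<bar>Z \<omega> - expectation Z\<bar> powr \<delta>)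
      \<le> expectation (\<lambda>\<omega>. 2 powr \<delta> * ((\<bar>Z \<omega>\<bar> powr \<delta> + \<bar>m\<bar> powr \<delta>) / 2))"
    using int pointwise by (intro integral_mono) (auto simp: m_def)
  also have "\<dots> = 2 powr \<delta> * ((expectation (\<lambda>\<omega>. \<bar>Z \<omega>\<bar> powr \<delta>) + \<bar>m\<bar> powr \<delta>) / 2)"
    using moment by (simp add: prob_space)
  also have "\<dots> \<le> 2 powr \<delta> * expectation (\<lambda>\<omega>. \<bar>Z \<omega>\<bar> powr \<delta>)"
    using jensen by (intro mult_left_mono) auto
  finally show "expectation (\<lambda>\<omega>. \<bar>Z \<omega> - expectation Z\<bar> powr \<delta>)
      \<le> 2 powr \<delta> * expectation (\<lambda>\<omega>. \<bar>Z \<omega>\<bar> powr \<delta>)" .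
qed

text \<open>
  The bound as a single power, with \<open>N\<close> cancelling. All quantities are positive, so it is enough to compare
  logarithms.
\<close>

lemma bound_parameter_eq:
  fixes N A v \<Delta> \<delta> :: real
  assumes "0 < N" "0 < A" "0 < v" "0 < \<Delta>" "2 < \<delta>"
  shows "((N / A) powr (1 / \<delta>) * sqrt (v\<^sup>2 / (N * \<Delta>))) powr (- (\<delta> / (\<delta> + 1)))
      * (\<Delta> / N) powr ((\<delta> - 2) / (2 * (\<delta> + 1)))
    = (A * \<Delta> powr (\<delta> - 1) / v powr \<delta>) powr (1 / (\<delta> + 1))" (is "?l = ?r")
proof -
  have s: "ln (sqrt (v\<^sup>2 / (N * \<Delta>))) = (2 * ln v - ln N - ln \<Delta>) / 2"
    using assms by (simp add: ln_sqrt ln_div ln_mult ln_realpow)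
  have x: "ln ((N / A) powr (1 / \<delta>) * sqrt (v\<^sup>2 / (N * \<Delta>)))
      = (ln N - ln A) / \<delta> + (2 * ln v - ln N - ln \<Delta>) / 2"
    using assms s by (simp add: ln_mult ln_div ln_powr)
  have l: "ln ?l = - (\<delta> / (\<delta> + 1)) * ((ln N - ln A) / \<delta> + (2 * ln v - ln N - ln \<Delta>) / 2)
      + ((\<delta> - 2) / (2 * (\<delta> + 1))) * (ln \<Delta> - ln N)"
    using assms x by (simp add: ln_mult ln_div ln_powr)
  have r: "ln ?r = (ln A + (\<delta> - 1) * ln \<Delta> - \<delta> * ln v) / (\<delta> + 1)"
    using assms by (simp add: ln_mult ln_div ln_powr)
  have "ln ?l = ln ?r"
    unfolding l r using assms by (simp add: divide_simps) (simp add: algebra_simps)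
  moreover have "0 < ?l" "0 < ?r" using assms by auto
  ultimately show ?thesis by (metis ln_inj_iff)
qed

lemma (in prob_space) kolmogorov_dist_le_one: "kolmogorov_dist_std_normal M Z \<le> 1"
  unfolding kolmogorov_dist_std_normal_def
proof (rule cSUP_least)
  fix t
  have "0 \<le> prob {\<omega> \<in> space M. Z \<omega> \<le> t}" "prob {\<omega> \<in> space M. Z \<omega> \<le> t} \<le> 1" by auto
  with std_normal.cdf_bounded_prob[of t] std_normal.cdf_nonneg[of t]
  show "\<bar>prob {\<omega> \<in> space M. Z \<omega> \<le> t} - normal_cdf t\<bar> \<le> 1" by linarith
qed simp

context centred_local_dependence
begin

text \<open>
  With \<open>r = \<epsilon> powr (1 / (\<delta> + 1))\<close> the claim is trivial for \<open>r > 1 / 8\<close>. Otherwise \<open>h\<^sup>2 = 2 powr \<delta> * \<epsilon>\<close> equals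
  \<open>(2 * r) powr \<delta> * r\<close>, which is at most \<open>r\<^sup>2 / 2\<close> because \<open>\<delta> > 2\<close> and \<open>2 * r \<le> 1\<close>. The smoothing bound
  \<open>8 * stein_error / h + 3 * h\<close> is at most \<open>11 * h\<close>, and \<open>11 / sqrt 2 < 8.015\<close>.
\<close>

lemma kolmogorov_dist_le_powr:
  assumes "stein_error \<le> 2 powr \<delta> * \<epsilon>"
  shows "kolmogorov_dist_std_normal M W \<le> 8.015 * \<epsilon> powr (1 / (\<delta> + 1))"
proof -
  define r where "r = \<epsilon> powr (1 / (\<delta> + 1))"
  have "0 < 2 powr \<delta> * \<epsilon>" using stein_error_pos assms by linarith
  then have \<epsilon>: "0 < \<epsilon>" by (simp add: zero_less_mult_iff)
  then have r: "0 < r" by (simp add: r_def)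
  have \<epsilon>_eq: "\<epsilon> = r powr \<delta> * r"
  proof -
    have "r powr \<delta> * r = r powr (\<delta> + 1)" using r by (simp add: powr_add)
    also have "\<dots> = \<epsilon>" using \<epsilon> \<delta> by (simp add: r_def powr_powr)
    finally show ?thesis by simp
  qed
  show ?thesis
  proof (cases "r \<le> 1 / 8")
    case False
    with kolmogorov_dist_le_one[of W] show ?thesis by (simp add: r_def[symmetric])
  next
    case True
    define h where "h = sqrt (2 powr \<delta> * \<epsilon>)"
    have h: "0 < h" "h\<^sup>2 = 2 powr \<delta> * \<epsilon>" using \<epsilon> by (auto simp: h_def)
    have "h\<^sup>2 = (2 * r) powr \<delta> * r" by (simp add: h \<epsilon>_eq powr_mult)
    also have "\<dots> \<le> (2 * r) powr 2 * r"
      using True r \<delta> by (intro mult_right_mono powr_mono') auto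
    also have "\<dots> = 4 * r * r\<^sup>2" using r by (simp add: power2_eq_square)
    also have "\<dots> \<le> 1 / 2 * r\<^sup>2" using True by (intro mult_right_mono) auto
    finally have h_le: "h\<^sup>2 \<le> 1 / 2 * r\<^sup>2" .
    have "r\<^sup>2 \<le> (1 / 8)\<^sup>2" using True r by (intro power_mono) auto
    with h_le have "h\<^sup>2 \<le> 1 / 10" by (simp add: power_divide)
    then have "kolmogorov_dist_std_normal M W \<le> 8 * stein_error / h + 3 * h"
      by (rule kolmogorov_dist_le_error[OF h(1)])
    also have "\<dots> \<le> 8 * h\<^sup>2 / h + 3 * h"
      using assms h by (intro add_right_mono divide_right_mono) auto
    also have "\<dots> = 11 * h" using h(1) by (simp add: power2_eq_square)
    also have "\<dots> \<le> 8.015 * r"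
    proof (rule power2_le_imp_le)
      have "60.5 * r\<^sup>2 \<le> 8.015\<^sup>2 * r\<^sup>2"
        by (intro mult_right_mono) (simp_all add: power_divide)
      moreover have "(11 * h)\<^sup>2 \<le> 60.5 * r\<^sup>2"
        using h_le by (simp add: power_mult_distrib)
      ultimately show "(11 * h)\<^sup>2 \<le> (8.015 * r)\<^sup>2"
        unfolding power_mult_distrib[of "8.015"] by (rule order_trans[rotated])
    qed (use r in simp)
    finally show ?thesis by (simp add: r_def)
  qed
qed

end

theorem theorem2p6:
  fixes M :: "'w measure"
    and V :: "'a set"
    and Y :: "'a \<Rightarrow> 'w \<Rightarrow> real"
    and c :: "'a \<Rightarrow> real"
    and E :: "'a uprod multiset"
    and N D :: nat
    and S W :: "'w \<Rightarrow> real"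
    and v A \<delta> \<xi> :: real
  assumes "prob_space M"
    and "finite V" and "card V = N" and "N \<ge> 1"
    and "\<And>k. k \<in> V \<Longrightarrow> Y k \<in> borel_measurable M"
    and "\<And>k. k \<in> V \<Longrightarrow> integrable M (\<lambda>\<omega>. (Y k \<omega>)\<^sup>2)"
    and "dependency_graph M V Y E" and "mg_max_degree V E = D"
    and S_def: "S = (\<lambda>\<omega>. \<Sum>k\<in>V. Y k \<omega>)"
    and v_def: "v = sqrt (prob_space.variance M S)"
    and W_def: "W = (\<lambda>\<omega>. (S \<omega> - prob_space.expectation M S) / v)"
    and "v > 0"
    and "2 < \<delta>" and "\<delta> < 3"
    and "\<And>k. k \<in> V \<Longrightarrow> integrable M (\<lambda>\<omega>. \<bar>Y k \<omega> - c k\<bar> powr \<delta>)"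
    and A_def: "A = (\<Sum>k\<in>V. prob_space.expectation M (\<lambda>\<omega>. \<bar>Y k \<omega> - c k\<bar> powr \<delta>))"
    and \<xi>_def: "\<xi> = (real N / A) powr (1 / \<delta>) *
                     sqrt (prob_space.variance M S / (real N * (real D + 1)))"
  shows "kolmogorov_dist_std_normal M W
          \<le> 8.015 * \<xi> powr (- (\<delta> / (\<delta> + 1))) *
            ((real D + 1) / real N) powr ((\<delta> - 2) / (2 * (\<delta> + 1)))"
proof -
  interpret prob_space M by fact
  note [measurable] = assms(5)
  have int_Y: "integrable M (Y k)" if "k \<in> V" for k
    using square_integrable_imp_integrable assms(5,6) that by blast
  define X where "X k \<omega> = (Y k \<omega> - expectation (Y k)) / v" for k \<omega>
  have var_eq: "variance S = v\<^sup>2"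
    using \<open>v > 0\<close> unfolding v_def by simp
  have ES: "expectation S = (\<Sum>k\<in>V. expectation (Y k))"
    unfolding S_def using int_Y by (rule Bochner_Integration.integral_sum)
  have W_eq: "W = (\<lambda>\<omega>. \<Sum>k\<in>V. X k \<omega>)"
    unfolding W_def X_def ES by (simp add: S_def sum_subtractf flip: sum_divide_distrib)
  have X_moment: "integrable M (\<lambda>\<omega>. \<bar>X k \<omega>\<bar> powr \<delta>)"
    "expectation (\<lambda>\<omega>. \<bar>X k \<omega>\<bar> powr \<delta>)
      \<le> 2 powr \<delta> * expectation (\<lambda>\<omega>. \<bar>Y k \<omega> - c k\<bar> powr \<delta>) / v powr \<delta>" if k: "k \<in> V" for k
  proof -
    have "expectation (\<lambda>\<omega>. Y k \<omega> - c k) = expectation (Y k) - c k"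
      using int_Y[OF k] by (simp add: prob_space)
    then have X_eq: "(\<lambda>\<omega>. \<bar>X k \<omega>\<bar> powr \<delta>)
        = (\<lambda>\<omega>. \<bar>(Y k \<omega> - c k) - expectation (\<lambda>\<omega>. Y k \<omega> - c k)\<bar> powr \<delta> / v powr \<delta>)"
      using \<open>v > 0\<close> by (simp add: X_def powr_divide)
    note c = centred_abs_moment_le[of "\<lambda>\<omega>. Y k \<omega> - c k" \<delta>]
    show "integrable M (\<lambda>\<omega>. \<bar>X k \<omega>\<bar> powr \<delta>)"
      unfolding X_eq using assms k int_Y[OF k] by (intro integrable_divide c(1)) auto
    show "expectation (\<lambda>\<omega>. \<bar>X k \<omega>\<bar> powr \<delta>)
      \<le> 2 powr \<delta> * expectation (\<lambda>\<omega>. \<bar>Y k \<omega> - c k\<bar> powr \<delta>) / v powr \<delta>"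
      unfolding X_eq integral_divide_zero using assms k int_Y[OF k]
      by (intro divide_right_mono c(2)) auto
  qed
  interpret X: centred_local_dependence M V X E D \<delta>
  proof unfold_locales
    show "finite V" "2 < \<delta>" "\<delta> < 3" by fact+
    show "dependency_graph M V X E"
      unfolding X_def[abs_def] using assms(1,7) by (rule dependency_graph_affine)
    show "expectation (\<lambda>\<omega>. (\<Sum>k\<in>V. X k \<omega>)\<^sup>2) = 1"
    proof -
      have "expectation (\<lambda>\<omega>. (\<Sum>k\<in>V. X k \<omega>)\<^sup>2) = expectation (\<lambda>\<omega>. (W \<omega>)\<^sup>2)"
        by (simp add: W_eq)
      also have "\<dots> = variance S / v\<^sup>2"
        by (simp add: W_def power_divide)
      finally show ?thesis using \<open>v > 0\<close> by (simp add: var_eq)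
    qed
    fix k assume k: "k \<in> V"
    show "mg_degree E k \<le> D"
      using assms(2,8) k unfolding mg_max_degree_def by (metis Max_ge finite_imageI imageI)
    show "X k \<in> borel_measurable M" unfolding X_def using k by measurable
    show "expectation (X k) = 0"
      unfolding X_def using int_Y[OF k] by (simp add: prob_space)
    show "integrable M (\<lambda>\<omega>. \<bar>X k \<omega>\<bar> powr \<delta>)" by (rule X_moment(1)[OF k])
    have "(\<lambda>\<omega>. (X k \<omega>)\<^sup>2) = (\<lambda>\<omega>. ((Y k \<omega>)\<^sup>2 - 2 * Y k \<omega> * expectation (Y k) + (expectation (Y k))\<^sup>2) / v\<^sup>2)"
      by (simp add: X_def power_divide power2_diff fun_eq_iff add_ac diff_add_eq)
    then show "integrable M (\<lambda>\<omega>. (X k \<omega>)\<^sup>2)"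
      using int_Y[OF k] assms(6)[OF k] by simp
  qed
  let ?\<epsilon> = "A * (real D + 1) powr (\<delta> - 1) / v powr \<delta>"
  have "(\<Sum>k\<in>V. X.abs_moment k) \<le> (\<Sum>k\<in>V. 2 powr \<delta> * expectation (\<lambda>\<omega>. \<bar>Y k \<omega> - c k\<bar> powr \<delta>) / v powr \<delta>)"
    unfolding X.abs_moment_def by (intro sum_mono X_moment(2))
  also have "\<dots> = 2 powr \<delta> * A / v powr \<delta>"
    by (simp add: A_def flip: sum_distrib_left sum_divide_distrib)
  finally have "X.stein_error \<le> (real D + 1) powr (\<delta> - 1) * (2 powr \<delta> * A / v powr \<delta>)"
    unfolding X.stein_error_def by (rule mult_left_mono) simp
  then have error_le: "X.stein_error \<le> 2 powr \<delta> * ?\<epsilon>" by (simp add: mult_ac)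
  have "0 < A"
  proof -
    have "0 < 2 powr \<delta> * ?\<epsilon>" using X.stein_error_pos error_le by linarith
    then show ?thesis using \<open>v > 0\<close> by (auto simp: zero_less_mult_iff zero_less_divide_iff)
  qed
  moreover have "0 < real N" using \<open>N \<ge> 1\<close> by simp
  ultimately have "\<xi> powr (- (\<delta> / (\<delta> + 1))) * ((real D + 1) / real N) powr ((\<delta> - 2) / (2 * (\<delta> + 1)))
      = ?\<epsilon> powr (1 / (\<delta> + 1))"
    unfolding \<xi>_def var_eq using \<open>v > 0\<close> \<open>2 < \<delta>\<close> by (intro bound_parameter_eq) auto
  moreover have "X.psum V = W" by (simp add: W_eq X.psum_def fun_eq_iff)
  ultimately show ?thesis
    using X.kolmogorov_dist_le_powr[OF error_le] by (simp add: mult.assoc)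
qed

end
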